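(* Let $r_0(\lambda)=\frac1{t_{0,0}(\lambda)}$, $s_1(\lambda)=\frac{t_{0,1}(\lambda)}{t_{0,0}(\lambda)}$, $s_2(\lambda)=\frac{t_{0,2}(\lambda)}{t_{0,0}(\lambda)}$, so that $r_0(\lambda)u_0(\lambda,x)=v_0(\lambda,x)+s_1(\lambda)v_1(\lambda,x)+s_2(\lambda)v_2(\lambda,x)$. As $x\to+\infty$, the function $r_0(\lambda)u_0(\lambda,x)$ has the asymptotic $$r_0(\lambda)u_0(\lambda,x)\to e^{iz_+\zeta_0x}+s_1(\lambda)e^{iz_+\zeta_1x}+s_2(\lambda)e^{iz_+\zeta_2x},$$ so the wave $e^{iz_+\zeta_0x}$ incident from $+\infty$ has the reflected (scattered) wave $s_1(\lambda)e^{iz_+\zeta_1x}+s_2(\lambda)e^{iz_+\zeta_2x}$, with scattering coefficients $s_1(\lambda)$, $s_2(\lambda)$. As $x\to-\infty$, $$r_0(\lambda)u_0(\lambda,x)\to r_0(\lambda)e^{iz_-\zeta_0x},$$ so $r_0(\lambda)$ is the coefficient of transformation of the wave $e^{iz_+\zeta_0x}$ into the wave $e^{iz_-\zeta_0x}$. With $k=n_-/n_+$ and $f^+(\lambda)=\overline{f(\overline\lambda)}$, the unitarity property of the scattering problem for the incident wave $e^{iz_+\zeta_0x}$ holds: $$k^2r_0(\lambda)r_0^+(\lambda)=1+\zeta_1s_1(\lambda)s_2^+(\lambda)+\zeta_2s_2(\lambda)s_1^+(\lambda).$$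
   Context: Setting: $m:\mathbb{R}\to\mathbb{R}$ is a real function having limits $m_\pm=\lim_{x\to\pm\infty}m(x)$ with $0<m_\pm<\infty$, and there is $a>0$ with $\int_{\mathbb{R}_\pm}|m(x)-m_\pm|^2e^{2a|x|}dx<\infty$. Put $n_\pm=m_\pm^{1/3}>0$, $z_\pm=\lambda n_\pm$. Let $\zeta_0=1$, $\zeta_1=\frac12(-1+i\sqrt3)$, $\zeta_2=\frac12(-1-i\sqrt3)$ and $\sigma(z)=\frac13\left(e^{\zeta_0z}+\zeta_1^{-2}e^{\zeta_1z}+\zeta_2^{-2}e^{\zeta_2z}\right)$. The equation under study is $iy'''(x)=m(x)\lambda^3y(x)$, $x\in\mathbb{R}$, $\lambda\in\mathbb{C}$. For $j=0,1,2$ the Jost solutions at $+\infty$, $v_j(\lambda,x)$, are the solutions of the equation with $v_j(\lambda,x)\to e^{iz_+\zeta_jx}$ as $x\to+\infty$, given by the integral equation $v_j(\lambda,x)=e^{iz_+\zeta_jx}-iz_+\int_x^\infty\sigma(iz_+(x-t))\left(\frac{m(t)}{m_+}-1\right)v_j(\lambda,t)dt$. The Jost solutions at $-\infty$, $u_j(\lambda,x)$, are the solutions with $u_j(\lambda,x)\to e^{iz_-\zeta_jx}$ as $x\to-\infty$, given by $u_j(\lambda,x)=e^{iz_-\zeta_jx}+iz_-\int_{-\infty}^x\sigma(iz_-(x-t))\left(\frac{m(t)}{m_-}-1\right)u_j(\lambda,t)dt$. The transition coefficients $t_{j,l}(\lambda)$ are the $x$-independent numbers with $u_j(\lambda,x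)=\sum_{l=0}^2t_{j,l}(\lambda)v_l(\lambda,x)$.
   Formalization: The coefficients in the unitarity identity are corrected: ζ₂ multiplies s₁s₂⁺ and ζ₁ multiplies s₂s₁⁺. The printed form fails, e.g. for m=3 on [0,1], m=1 elsewhere, λ=0.3. Assumed: λ≠0, Jost solutions exist at λ and its conjugate, t₀,₀≠0 there. *)

theory Defs
  imports "HOL-Analysis.Analysis"
begin

definition zeta :: "nat \<Rightarrow> complex" where
  "zeta j = (if j = 0 then 1
             else if j = 1 then (- 1 + \<i> * of_real (sqrt 3)) / 2
             else (- 1 - \<i> * of_real (sqrt 3)) / 2)"

definition sigma :: "complex \<Rightarrow> complex" where
  "sigma z = (1 / 3) * (\<Sum>j<3. exp (zeta j * z) / (zeta j)\<^sup>2)"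

text \<open>The function \<open>m\<close> with limits \<open>mp\<close>, \<open>mm\<close> at plus and minus infinity and decay rate \<open>a\<close>.
  Measurability of \<open>m\<close> is part of the meaning of the two integrals but does not follow from
  integrability of the squares, so it is listed.\<close>

definition admissible :: "(real \<Rightarrow> real) \<Rightarrow> real \<Rightarrow> real \<Rightarrow> real \<Rightarrow> bool" where
  "admissible m mp mm a \<longleftrightarrow>
     m \<in> borel_measurable lebesgue \<and>
     (m \<longlongrightarrow> mp) at_top \<and> (m \<longlongrightarrow> mm) at_bot \<and> 0 < mp \<and> 0 < mm \<and> 0 < a \<and>
     (\<lambda>x. \<bar>m x - mp\<bar>\<^sup>2 * exp (2 * a * \<bar>x\<bar>)) absolutely_integrable_on {0..} \<and>
     (\<lambda>x. \<bar>m x - mm\<bar>\<^sup>2 * exp (2 * a * \<bar>x\<bar>)) absolutely_integrable_on {..0}"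

text \<open>Solutions of \<open>i y''' = m \<mu>^3 y\<close>. As \<open>m\<close> need not be continuous, the equation is
  understood
  in the Caratheodory sense: \<open>y\<close> is twice differentiable, \<open>y''\<close> is locally absolutely continuous
  and the equation holds almost everywhere, which is the integrated form below.\<close>

definition solves_eq :: "(real \<Rightarrow> real) \<Rightarrow> complex \<Rightarrow> (real \<Rightarrow> complex) \<Rightarrow> bool" where
  "solves_eq m \<mu> y \<longleftrightarrow>
     (\<exists>y' y''. (\<forall>x. (y has_vector_derivative y' x) (at x)) \<and>
               (\<forall>x. (y' has_vector_derivative y'' x) (at x)) \<and>
               (\<forall>c d. c \<le> d \<longrightarrow>
                  (\<lambda>x. of_real (m x) * \<mu> ^ 3 * y x) absolutely_integrable_on {c..d} \<and>
                  \<i> * (y'' d - y'' c) = integral {c..d} (\<lambda>x. of_real (m x) * \<mu> ^ 3 * y x)))"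

text \<open>\<open>z\<^sub>+ = \<mu> n\<^sub>+\<close> and \<open>z\<^sub>- = \<mu> n\<^sub>-\<close>, where \<open>n\<close> is the cube root of the limit \<open>c\<close> of \<open>m\<close>.\<close>

definition zlim :: "real \<Rightarrow> complex \<Rightarrow> complex" where
  "zlim c \<mu> = \<mu> * of_real (root 3 c)"

definition wave :: "real \<Rightarrow> nat \<Rightarrow> complex \<Rightarrow> real \<Rightarrow> complex" where
  "wave c j \<mu> x = exp (\<i> * zlim c \<mu> * zeta j * of_real x)"

definition jost_plus ::
  "(real \<Rightarrow> real) \<Rightarrow> real \<Rightarrow> nat \<Rightarrow> complex \<Rightarrow> (real \<Rightarrow> complex) \<Rightarrow> bool" where
  "jost_plus m mp j \<mu> v \<longleftrightarrow>
     solves_eq m \<mu> v \<and>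
     ((\<lambda>x. v x - wave mp j \<mu> x) \<longlongrightarrow> 0) at_top \<and>
     (\<forall>x. (\<lambda>t. sigma (\<i> * zlim mp \<mu> * of_real (x - t)) * of_real (m t / mp - 1) * v t)
             absolutely_integrable_on {x..} \<and>
          v x = wave mp j \<mu> x - \<i> * zlim mp \<mu> *
             integral {x..} (\<lambda>t. sigma (\<i> * zlim mp \<mu> * of_real (x - t)) *
                                 of_real (m t / mp - 1) * v t))"

definition jost_minus ::
  "(real \<Rightarrow> real) \<Rightarrow> real \<Rightarrow> nat \<Rightarrow> complex \<Rightarrow> (real \<Rightarrow> complex) \<Rightarrow> bool" where
  "jost_minus m mm j \<mu> u \<longleftrightarrow>
     solves_eq m \<mu> u \<and>
     ((\<lambda>x. u x - wave mm j \<mu> x) \<longlongrightarrow> 0) at_bot \<and>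
     (\<forall>x. (\<lambda>t. sigma (\<i> * zlim mm \<mu> * of_real (x - t)) * of_real (m t / mm - 1) * u t)
             absolutely_integrable_on {..x} \<and>
          u x = wave mm j \<mu> x + \<i> * zlim mm \<mu> *
             integral {..x} (\<lambda>t. sigma (\<i> * zlim mm \<mu> * of_real (x - t)) *
                                 of_real (m t / mm - 1) * u t))"

definition conj_plus :: "(complex \<Rightarrow> complex) \<Rightarrow> complex \<Rightarrow> complex" where
  "conj_plus f \<mu> = cnj (f (cnj \<mu>))"

text \<open>In the unitarity identity the coefficient of \<open>s\<^sub>1 s\<^sub>2\<^sup>+\<close> is \<open>zeta 1 ^ 2 = zeta 2\<close>, and that of
  \<open>s\<^sub>2 s\<^sub>1\<^sup>+\<close> is \<open>zeta 2 ^ 2 = zeta 1\<close>: with \<open>w\<^sup>+(x) = cnj (w (cnj \<mu>) x)\<close>, the bracket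
  \<open>y'' w\<^sup>+ - y' w\<^sup>+' + y w\<^sup>+''\<close> of two solutions is constant, and it equals \<open>-3 z\<^sup>2 (zeta j)\<^sup>2\<close> on the
  pair \<open>exp (i z zeta\<^sub>j x)\<close>, \<open>exp (-i z zeta\<^sub>j x)\<close>. The source prints these two coefficients
  interchanged; with them interchanged the identity fails already for small piecewise constant
  perturbations of \<open>m = 1\<close>.\<close>

end

theory Submission
  imports Defs
begin

text \<open>Put \<open>\<alpha> = \<i> z\<close> and \<open>\<beta>\<^sub>l = \<alpha> \<zeta>\<^sub>l\<close>. A solution \<open>y\<close> is decomposed into exponential modes with coefficients
  \<open>P\<^sub>l(x) = e\<^bsup>-\<beta>\<^sub>l x\<^esup> (y'' + \<beta>\<^sub>l y' + \<beta>\<^sub>l\<^sup>2 y)\<close>, for which \<open>P\<^sub>l' = \<alpha>\<^sup>3 e\<^bsup>-\<beta>\<^sub>l x\<^esup> q y\<close> almost everywhere, where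
  \<open>q = m / m\<^sub>\<plusminus> - 1\<close>. The integral equation makes the right-hand side integrable and, the exponentials
  being independent, forces \<open>P\<^sub>l \<rightarrow> 3 \<beta>\<^sub>l\<^sup>2 \<delta>\<^sub>j\<^sub>l\<close> for the \<open>j\<close>-th Jost solution. If \<open>w\<close> solves the conjugate
  equation and has mode coefficients \<open>Q\<^sub>l\<close> for \<open>-\<beta>\<^sub>l\<close>, the bracket \<open>y'' w - y' w' + y w''\<close> is constant
  and equals \<open>\<Sum>\<^sub>l P\<^sub>l Q\<^sub>l / (3 \<beta>\<^sub>l\<^sup>2)\<close>: no exponential factors remain, so its limits at both ends can be
  read off for every \<open>\<lambda>\<close>, without comparing growth rates of the solutions. Equating the two limits
  for \<open>u\<^sub>0\<close> and \<open>u\<^sub>0\<^sup>+\<close> is the unitarity identity.\<close>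

section \<open>Locally absolutely continuous functions\<close>

text \<open>The integral form of local absolute continuity: \<open>g\<close> acts as an almost
  everywhere derivative although no pointwise derivative is mentioned. \<open>solves_eq\<close>
  states the equation for the second derivative in this form.\<close>

definition ac_deriv :: "(real \<Rightarrow> complex) \<Rightarrow> (real \<Rightarrow> complex) \<Rightarrow> bool" where
  "ac_deriv f g \<longleftrightarrow> (\<forall>c d. c \<le> d \<longrightarrow>
     g absolutely_integrable_on {c..d} \<and> f d - f c = integral {c..d} g)"

lemma ac_derivD:
  assumes "ac_deriv f g" "c \<le> d"
  shows "g absolutely_integrable_on {c..d}" "f d - f c = integral {c..d} g"
  using assms unfolding ac_deriv_def by blast+

lemma ac_deriv_cong:
  assumes "ac_deriv f g" "\<And>x. f x = f' x" "\<And>x. g x = g' x"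
  shows "ac_deriv f' g'"
proof -
  have "f = f'" "g = g'" using assms(2,3) by auto
  then show ?thesis using assms(1) by simp
qed

lemma ac_deriv_add:
  assumes "ac_deriv f g" "ac_deriv f' g'"
  shows "ac_deriv (\<lambda>x. f x + f' x) (\<lambda>x. g x + g' x)"
  using ac_derivD[OF assms(1)] ac_derivD[OF assms(2)] unfolding ac_deriv_def
  by (auto simp: set_lebesgue_integral_eq_integral(1) algebra_simps Henstock_Kurzweil_Integration.integral_add)

lemma ac_deriv_cmult:
  assumes "ac_deriv f g"
  shows "ac_deriv (\<lambda>x. c * f x) (\<lambda>x. c * g x)"
  using ac_derivD[OF assms] unfolding ac_deriv_def
  by (auto simp flip: right_diff_distrib)

lemma ac_deriv_cnj:
  assumes "ac_deriv f g"
  shows "ac_deriv (\<lambda>x. cnj (f x)) (\<lambda>x. cnj (g x))"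
  unfolding ac_deriv_def
proof (intro allI impI conjI)
  fix c d :: real assume "c \<le> d"
  note * = ac_derivD[OF assms this]
  show "(\<lambda>x. cnj (g x)) absolutely_integrable_on {c..d}"
    using absolutely_integrable_linear[OF *(1) bounded_linear_cnj] by (simp add: o_def)
  show "cnj (f d) - cnj (f c) = integral {c..d} (\<lambda>x. cnj (g x))"
    using *(2) by (metis complex_cnj_diff Henstock_Kurzweil_Integration.integral_cnj)
qed

lemma ac_deriv_of_vector_derivative:
  assumes f: "\<And>x. (f has_vector_derivative f' x) (at x)" and c: "continuous_on UNIV f'"
  shows "ac_deriv f f'"
  unfolding ac_deriv_def
proof (intro allI impI conjI)
  fix c d :: real assume cd: "c \<le> d"
  show "f' absolutely_integrable_on {c..d}"
    using absolutely_integrable_continuous_real continuous_on_subset[OF c] by blast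
  have "(f' has_integral f d - f c) {c..d}"
    by (rule fundamental_theorem_of_calculus[OF cd has_vector_derivative_at_within[OF f]])
  then show "f d - f c = integral {c..d} f'" by (simp add: integral_unique)
qed

lemma ac_deriv_continuous:
  assumes "ac_deriv f g"
  shows "continuous_on UNIV f"
proof (rule continuous_at_imp_continuous_on, intro ballI)
  fix x :: real
  have "g integrable_on {x-1..x+1}"
    using ac_derivD(1)[OF assms, of "x-1" "x+1"] set_lebesgue_integral_eq_integral(1) by auto
  then have "continuous_on {x-1..x+1} (\<lambda>y. f (x-1) + integral {x-1..y} g)"
    by (intro continuous_intros indefinite_integral_continuous_1)
  moreover have "f (x-1) + integral {x-1..y} g = f y" if "y \<in> {x-1..x+1}" for y
    using ac_derivD(2)[OF assms, of "x-1" y] that by (simp add: algebra_simps)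
  ultimately have "continuous_on {x-1..x+1} f"
    using continuous_on_cong by (metis (no_types, lifting))
  then show "isCont f x"
    by (rule continuous_on_interior) simp
qed

lemma ac_deriv_zero_imp_constant:
  assumes "ac_deriv f (\<lambda>x. 0)"
  shows "f x = f y"
  using ac_derivD(2)[OF assms, of x y] ac_derivD(2)[OF assms, of y x] by (cases "x \<le> y") auto

section \<open>Product rule with one absolutely continuous factor\<close>

lemma absolutely_integrable_mult_continuous:
  fixes f g :: "real \<Rightarrow> complex"
  assumes f: "f absolutely_integrable_on {c..d}" and g: "continuous_on {c..d} g"
  shows "(\<lambda>x. f x * g x) absolutely_integrable_on {c..d}"
proof -
  have "(\<lambda>x. g x * f x) absolutely_integrable_on {c..d}"
  proof (rule absolutely_integrable_bounded_measurable_product[where h = "(*)", OF _ _ _ _ f])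
    show "bilinear ((*) :: complex \<Rightarrow> complex \<Rightarrow> complex)"
      by (simp add: bilinear_def linear_iff algebra_simps)
    show "g \<in> borel_measurable (lebesgue_on {c..d})"
      using g by (intro continuous_imp_measurable_on_sets_lebesgue) auto
    show "bounded (g ` {c..d})"
      using g by (intro compact_imp_bounded compact_continuous_image) auto
  qed auto
  then show ?thesis by (simp add: mult.commute)
qed

text \<open>Dividing by \<open>y - x\<close> bounds the difference quotients of \<open>F\<close> by
  increments of the continuous \<open>A\<close>, which tend to zero. So \<open>F\<close> has
  derivative zero at every point, not merely almost everywhere, and is constant.\<close>

lemma eq_of_increment_bound:
  fixes F :: "real \<Rightarrow> complex" and A :: "real \<Rightarrow> real"
  assumes cd: "c \<le> d" and A: "continuous_on {c..d} A"
    and F: "\<And>x y. c \<le> x \<Longrightarrow> x \<le> y \<Longrightarrow> y \<le> d \<Longrightarrow> norm (F y - F x) \<le> (y - x) * (A y - A x)"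
  shows "F d = F c"
proof -
  have "(F has_derivative (\<lambda>h. 0)) (at x within {c..d})" if x: "x \<in> {c..d}" for x
    unfolding has_derivative_iff_norm
  proof (intro conjI)
    have lim: "((\<lambda>y. \<bar>A y - A x\<bar>) \<longlongrightarrow> 0) (at x within {c..d})"
      using A x unfolding continuous_on_def
      by (intro tendsto_rabs_zero) (auto simp: LIM_zero_iff)
    have "norm (F y - F x) / norm (y - x) \<le> \<bar>A y - A x\<bar>" if y: "y \<in> {c..d}" "y \<noteq> x" for y
    proof (cases "x \<le> y")
      case True
      with F[of x y] x y have "norm (F y - F x) \<le> (y - x) * (A y - A x)" by auto
      also have "\<dots> \<le> \<bar>A y - A x\<bar> * (y - x)"
        using True by (auto simp: mult.commute intro: mult_left_mono)
      finally show ?thesis using True y by (simp add: field_simps)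
    next
      case False
      with F[of y x] x y have "norm (F x - F y) \<le> (x - y) * (A x - A y)" by auto
      also have "\<dots> \<le> \<bar>A y - A x\<bar> * (x - y)"
        using False by (subst mult.commute) (intro mult_right_mono; auto)
      finally show ?thesis using False y by (simp add: field_simps norm_minus_commute)
    qed
    then have "\<forall>\<^sub>F y in at x within {c..d}. norm (norm (F y - F x - 0) / norm (y - x)) \<le> \<bar>A y - A x\<bar>"
      by (auto simp: eventually_at intro!: exI[of _ 1])
    then show "((\<lambda>y. norm (F y - F x - 0) / norm (y - x)) \<longlongrightarrow> 0) (at x within {c..d})"
      by (rule Lim_null_comparison[OF _ lim])
  qed auto
  then show ?thesis
    using has_derivative_zero_unique[of "{c..d}" F d c] cd by auto
qed

text \<open>Only the first factor may have a merely integrable derivative. This covers every product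
  below, since the second derivative of a solution is only ever multiplied by a continuously
  differentiable function.\<close>

lemma ac_deriv_mult:
  assumes f: "ac_deriv f g"
    and h: "\<And>x. (h has_vector_derivative h' x) (at x)" and h': "continuous_on UNIV h'"
  shows "ac_deriv (\<lambda>x. f x * h x) (\<lambda>x. g x * h x + f x * h' x)"
  unfolding ac_deriv_def
proof (intro allI impI)
  fix c d :: real assume cd: "c \<le> d"
  have fc: "continuous_on S f" for S
    using continuous_on_subset[OF ac_deriv_continuous[OF f]] by simp
  have hc: "continuous_on S h" for S
    by (meson continuous_at_imp_continuous_on h has_vector_derivative_continuous)
  have h'c: "continuous_on S h'" for S
    using continuous_on_subset[OF h'] by simp
  let ?G = "\<lambda>x. g x * h x + f x * h' x"
  have gi: "g absolutely_integrable_on {x..y}" if "x \<le> y" for x y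
    using ac_derivD(1)[OF f that] .
  have i1: "(\<lambda>x. g x * k x) absolutely_integrable_on {x..y}"
    if "x \<le> y" "continuous_on {x..y} k" for k x y
    using absolutely_integrable_mult_continuous[OF gi] that by blast
  have Gi: "?G absolutely_integrable_on {x..y}" if "x \<le> y" for x y
    using that by (intro set_integral_add i1 absolutely_integrable_continuous_real continuous_intros fc hc h'c)
  obtain H where H: "\<And>x. x \<in> {c..d} \<Longrightarrow> norm (h' x) \<le> H"
    using compact_imp_bounded[OF compact_continuous_image[OF h'c compact_Icc, of c d]]
    unfolding bounded_iff by blast
  have "norm (h' c) \<le> H" using H[of c] cd by simp
  then have H0: "0 \<le> H" using norm_ge_zero order_trans by blast
  \<comment> \<open>The factor 2 counts the two summands of \<open>?D\<close> below: each
    contributes at most \<open>H * (y - x)\<close> times the integral of \<open>norm (g t)\<close>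
    over \<open>{x..y}\<close>.\<close>
  define A where "A x = 2 * H * integral {c..x} (\<lambda>t. norm (g t))" for x
  have ng: "(\<lambda>t. norm (g t)) integrable_on {x..y}" if "x \<le> y" for x y
    using gi[OF that] absolutely_integrable_on_def by blast
  \<comment> \<open>\<open>g\<close> is merely integrable, but the increments of \<open>F\<close> over \<open>{x..y}\<close> are at most \<open>y - x\<close> times those
    of the continuous function \<open>A\<close>, so \<open>F\<close> has derivative zero everywhere.\<close>
  define F where "F x = f x * h x - integral {c..x} ?G" for x
  have "F d = F c"
  proof (rule eq_of_increment_bound[OF cd, of A])
    show "continuous_on {c..d} A"
      unfolding A_def by (intro continuous_intros indefinite_integral_continuous_1 ng cd)
  next
    fix x y assume x: "c \<le> x" and xy: "x \<le> y" and y: "y \<le> d"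
    have Ginc: "integral {c..y} ?G - integral {c..x} ?G = integral {x..y} ?G"
      using Henstock_Kurzweil_Integration.integral_combine[OF x xy, of ?G]
        set_lebesgue_integral_eq_integral(1)[OF Gi[of c y]] x xy
      by (simp add: diff_eq_eq add.commute)
    have ninc: "integral {c..y} (\<lambda>t. norm (g t)) - integral {c..x} (\<lambda>t. norm (g t))
        = integral {x..y} (\<lambda>t. norm (g t))"
      using Henstock_Kurzweil_Integration.integral_combine[OF x xy ng[of c y]] x xy
      by (simp add: diff_eq_eq add.commute)
    let ?N = "integral {x..y} (\<lambda>t. norm (g t))"
    let ?D = "\<lambda>t. g t * (h y - h t) + (f x - f t) * h' t"
    have Di: "?D integrable_on {x..y}"
      by (intro set_lebesgue_integral_eq_integral(1) set_integral_add i1 xy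
          absolutely_integrable_continuous_real continuous_intros fc hc h'c)
    have h_int: "(h' has_integral h y - h x) {x..y}"
      by (rule fundamental_theorem_of_calculus[OF xy has_vector_derivative_at_within[OF h]])
    have g_int: "(g has_integral f y - f x) {x..y}"
      using set_lebesgue_integral_eq_integral(1)[OF gi[OF xy]] ac_derivD(2)[OF f xy]
      by (simp add: has_integral_integral)
    have G_int: "(?G has_integral integral {x..y} ?G) {x..y}"
      using set_lebesgue_integral_eq_integral(1)[OF Gi[OF xy]] by (rule integrable_integral)
    have "((\<lambda>t. g t * h y + f x * h' t - ?G t) has_integral
        (f y - f x) * h y + f x * (h y - h x) - integral {x..y} ?G) {x..y}"
      by (intro has_integral_diff has_integral_add has_integral_mult_left has_integral_mult_right
          h_int g_int G_int)
    moreover have "F y - F x = (f y - f x) * h y + f x * (h y - h x) - integral {x..y} ?G"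
      unfolding F_def Ginc[symmetric] by (simp add: algebra_simps)
    moreover have "(\<lambda>t. g t * h y + f x * h' t - ?G t) = ?D"
      by (auto simp: algebra_simps)
    ultimately have FD: "F y - F x = integral {x..y} ?D"
      by (simp add: integral_unique)
    have "norm (integral {x..y} ?D) \<le> integral {x..y} (\<lambda>t. norm (g t) * (H * (y - x)) + ?N * H)"
    proof (rule Henstock_Kurzweil_Integration.integral_norm_bound_integral[OF Di])
      show "(\<lambda>t. norm (g t) * (H * (y - x)) + ?N * H) integrable_on {x..y}"
        by (intro integrable_add integrable_on_mult_left ng xy integrable_const_ivl)
      fix t assume t: "t \<in> {x..y}"
      then have xt: "x \<le> t" by simp
      have "(h' has_integral h y - h t) {t..y}"
        using t by (intro fundamental_theorem_of_calculus has_vector_derivative_at_within[OF h]) auto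
      then have "norm (h y - h t) \<le> H * (y - t)"
        using has_integral_bound_real[of H "{}" h' "h y - h t" t y] H0 H t x y by auto
      also have "\<dots> \<le> H * (y - x)" using t H0 by (intro mult_left_mono) auto
      finally have h_le: "norm (h y - h t) \<le> H * (y - x)" .
      have "norm (f t - f x) \<le> integral {x..t} (\<lambda>t. norm (g t))"
        unfolding ac_derivD(2)[OF f xt]
        by (rule Henstock_Kurzweil_Integration.integral_norm_bound_integral
            [OF set_lebesgue_integral_eq_integral(1)[OF gi[OF xt]] ng[OF xt]]) simp
      also have "\<dots> \<le> ?N"
        using t ng[OF xy] ng[OF xt] by (intro integral_subset_le) auto
      finally have f_le: "norm (f x - f t) \<le> ?N" by (simp add: norm_minus_commute)
      have "norm (?D t) \<le> norm (g t) * norm (h y - h t) + norm (f x - f t) * norm (h' t)"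
        by (metis norm_mult norm_triangle_ineq)
      also have "\<dots> \<le> norm (g t) * (H * (y - x)) + ?N * H"
        using h_le f_le H[of t] t x y order_trans[OF norm_ge_zero f_le]
        by (intro add_mono mult_mono) auto
      finally show "norm (?D t) \<le> norm (g t) * (H * (y - x)) + ?N * H" .
    qed
    also have "integral {x..y} (\<lambda>t. norm (g t) * (H * (y - x)) + ?N * H)
        = ?N * (H * (y - x)) + (y - x) * (?N * H)"
      using xy ng[OF xy]
      by (subst Henstock_Kurzweil_Integration.integral_add) (auto intro: integrable_on_mult_left)
    also have "\<dots> = (y - x) * (A y - A x)"
      unfolding A_def ninc[symmetric] by (simp add: algebra_simps)
    finally show "norm (F y - F x) \<le> (y - x) * (A y - A x)" unfolding FD .
  qed
  then show "?G absolutely_integrable_on {c..d} \<and> f d * h d - f c * h c = integral {c..d} ?G"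
    using Gi[OF cd] by (auto simp: F_def algebra_simps)
qed

section \<open>Indefinite integrals over half-lines\<close>

lemma integral_atLeast_split:
  fixes g :: "real \<Rightarrow> complex"
  assumes g: "\<And>x. g absolutely_integrable_on {x..}" and cd: "c \<le> d"
  shows "integral {c..} g = integral {c..d} g + integral {d..} g"
proof -
  have i: "g absolutely_integrable_on {c..d}"
    using set_integrable_subset[OF g[of c], of "{c..d}"] by auto
  have neg: "negligible ({c..d} \<inter> {d..})"
    by (rule negligible_subset[of "{d}"]) auto
  have "(g has_integral integral {c..d} g + integral {d..} g) ({c..d} \<union> {d..})"
    using set_lebesgue_integral_eq_integral(1)[OF i] set_lebesgue_integral_eq_integral(1)[OF g[of d]]
    by (intro has_integral_Un neg integrable_integral)
  moreover have "{c..d} \<union> {d..} = {c..}" using cd by auto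
  ultimately show ?thesis by (simp add: integral_unique)
qed

text \<open>The lower limit of integration moves, so the minus sign is what makes \<open>g\<close>
  itself the derivative.\<close>

lemma tail_integral_at_top:
  fixes g :: "real \<Rightarrow> complex"
  assumes g: "\<And>x. g absolutely_integrable_on {x..}"
  shows "ac_deriv (\<lambda>x. - integral {x..} g) g" "((\<lambda>x. - integral {x..} g) \<longlongrightarrow> 0) at_top"
proof -
  have i: "g absolutely_integrable_on {c..d}" for c d
    using set_integrable_subset[OF g[of c], of "{c..d}"] by auto
  note split = integral_atLeast_split[OF g]
  show "ac_deriv (\<lambda>x. - integral {x..} g) g"
    unfolding ac_deriv_def using i split by auto
  have "((\<lambda>b. integral {0..b} g) \<longlongrightarrow> integral {0..} g) at_top"
    using tendsto_set_lebesgue_integral_at_top[of 0 lebesgue g] g[of 0] i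
    by (simp add: set_lebesgue_integral_eq_integral(2))
  then have "((\<lambda>b. integral {0..b} g - integral {0..} g) \<longlongrightarrow> 0) at_top"
    by (simp add: LIM_zero_iff)
  moreover have "\<forall>\<^sub>F b in at_top. integral {0..b} g - integral {0..} g = - integral {b..} g"
    using eventually_ge_at_top[of 0] by eventually_elim (simp add: split)
  ultimately show "((\<lambda>x. - integral {x..} g) \<longlongrightarrow> 0) at_top"
    by (rule Lim_transform_eventually)
qed

lemma tail_integral_at_bot:
  fixes g :: "real \<Rightarrow> complex"
  assumes g: "\<And>x. g absolutely_integrable_on {..x}"
  shows "ac_deriv (\<lambda>x. integral {..x} g) g" "((\<lambda>x. integral {..x} g) \<longlongrightarrow> 0) at_bot"
proof -
  have i: "g absolutely_integrable_on {c..d}" for c d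
    using set_integrable_subset[OF g[of d], of "{c..d}"] by auto
  have split: "integral {..d} g = integral {..c} g + integral {c..d} g" if cd: "c \<le> d" for c d
  proof -
    have neg: "negligible ({..c} \<inter> {c..d})"
      by (rule negligible_subset[of "{c}"]) auto
    have "(g has_integral integral {..c} g + integral {c..d} g) ({..c} \<union> {c..d})"
      using set_lebesgue_integral_eq_integral(1)[OF i] set_lebesgue_integral_eq_integral(1)[OF g[of c]]
      by (intro has_integral_Un neg integrable_integral)
    moreover have "{..c} \<union> {c..d} = {..d}" using cd by auto
    ultimately show ?thesis by (simp add: integral_unique)
  qed
  show "ac_deriv (\<lambda>x. integral {..x} g) g"
    unfolding ac_deriv_def using i split by auto
  have "((\<lambda>b. integral {b..0} g) \<longlongrightarrow> integral {..0} g) at_bot"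
    using tendsto_set_lebesgue_integral_at_bot[of 0 lebesgue g] g[of 0] i
    by (simp add: set_lebesgue_integral_eq_integral(2))
  then have "((\<lambda>b. integral {..0} g - integral {b..0} g) \<longlongrightarrow> integral {..0} g - integral {..0} g) at_bot"
    by (intro tendsto_intros)
  moreover have "\<forall>\<^sub>F b in at_bot. integral {..0} g - integral {b..0} g = integral {..b} g"
    using eventually_le_at_bot[of 0] by eventually_elim (simp add: split)
  ultimately have "((\<lambda>x. integral {..x} g) \<longlongrightarrow> integral {..0} g - integral {..0} g) at_bot"
    by (rule Lim_transform_eventually)
  then show "((\<lambda>x. integral {..x} g) \<longlongrightarrow> 0) at_bot" by simp
qed

section \<open>Exponentials with the cube roots of unity\<close>

lemma sum_lessThan_3: "(\<Sum>l<3::nat. f l) = f 0 + f 1 + f 2"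
  by (simp add: eval_nat_numeral add.assoc)

lemma less_3_cases:
  assumes "(l::nat) < 3"
  obtains "l = 0" | "l = 1" | "l = 2"
  using assms by linarith

lemma zeta_0 [simp]: "zeta 0 = 1"
  by (simp add: zeta_def)

lemma zeta_2: "zeta 2 = - 1 - zeta 1"
  by (simp add: zeta_def field_simps)

lemma zeta_1_square: "(zeta 1)\<^sup>2 = - 1 - zeta 1"
  by (simp add: zeta_def complex_eq_iff power2_eq_square field_simps)

lemma zeta_cube:
  assumes "l < 3"
  shows "zeta l ^ 3 = 1"
proof -
  have "zeta 1 ^ 3 = 1" "(- 1 - zeta 1) ^ 3 = 1"
    using zeta_1_square by algebra+
  then show ?thesis using assms by (auto elim!: less_3_cases simp: zeta_2)
qed

lemma zeta_nonzero: "l < 3 \<Longrightarrow> zeta l \<noteq> 0"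
  using zeta_cube[of l] by auto

lemma norm_zeta: "l < 3 \<Longrightarrow> norm (zeta l) = 1"
  using zeta_cube[of l] power_eq_imp_eq_base[of "norm (zeta l)" 3 1] by (simp flip: norm_power)

lemma inverse_zeta_square: "l < 3 \<Longrightarrow> 1 / (zeta l)\<^sup>2 = zeta l"
  using zeta_cube[of l] zeta_nonzero[of l]
  by (simp add: divide_eq_eq power2_eq_square power3_eq_cube mult.assoc)

lemma cnj_zeta_1: "cnj (zeta 1) = zeta 2"
  by (simp add: zeta_def complex_eq_iff)

lemma cnj_zeta_2: "cnj (zeta 2) = zeta 1"
  by (simp add: zeta_def complex_eq_iff)

lemma zeta_distinct: "zeta 0 \<noteq> zeta 1" "zeta 0 \<noteq> zeta 2" "zeta 1 \<noteq> zeta 2"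
  by (auto simp: zeta_def complex_eq_iff)

text \<open>Elimination in a Vandermonde system with the nodes \<open>e\<^bsup>\<alpha> \<zeta>\<^sub>j h\<^esup>\<close>; the bound on \<open>\<alpha> h\<close> keeps the nodes
  distinct.\<close>

lemma exp_separation:
  assumes \<alpha>: "\<alpha> \<noteq> 0" and h: "h \<noteq> 0" "norm (\<alpha> * of_real h) \<le> 1" and l: "l < 3"
  shows "\<exists>r p q. r \<noteq> 0 \<and> (\<forall>E. (\<Sum>j<3. exp (\<alpha> * zeta j * of_real h) ^ 2 * E j)
          + p * (\<Sum>j<3. exp (\<alpha> * zeta j * of_real h) * E j) + q * (\<Sum>j<3. E j) = r * E l)"
proof -
  define b where "b j = exp (\<alpha> * zeta j * of_real h)" for j
  have inj: "b j \<noteq> b k" if "j < 3" "k < 3" "zeta j \<noteq> zeta k" for j k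
  proof
    assume eq: "b j = b k"
    \<comment> \<open>Exponents with imaginary parts in [-1, 1] differ there by at most 2, which is
      less than a period of the exponential, so equal nodes would have equal exponents.\<close>
    have le: "\<bar>Im (\<alpha> * zeta i * of_real h)\<bar> \<le> 1" if "i < 3" for i
      using abs_Im_le_cmod[of "\<alpha> * zeta i * of_real h"] h(2) norm_zeta[OF that]
      by (simp add: norm_mult)
    have "\<bar>Im (\<alpha> * zeta j * of_real h) - Im (\<alpha> * zeta k * of_real h)\<bar> < 2 * pi"
      using le[OF that(1)] le[OF that(2)] pi_gt3 by linarith
    then have "\<alpha> * zeta j * of_real h = \<alpha> * zeta k * of_real h"
      using eq exp_complex_eqI unfolding b_def by blast
    then show False using \<alpha> h that by simp
  qed
  obtain m n where mn: "m < 3" "n < 3" "zeta l \<noteq> zeta m" "zeta l \<noteq> zeta n"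
    and S: "\<And>E. (\<Sum>j<3. E j) = (E l + E m + E n :: complex)"
  proof (rule less_3_cases[OF l])
    assume "l = 0" then show ?thesis
      using that[of 1 2] zeta_distinct by (auto simp: sum_lessThan_3)
  next
    assume "l = 1" then show ?thesis
      using that[of 0 2] zeta_distinct by (auto simp: sum_lessThan_3)
  next
    assume "l = 2" then show ?thesis
      using that[of 0 1] zeta_distinct by (auto simp: sum_lessThan_3)
  qed
  show ?thesis
  proof (intro exI conjI allI)
    \<comment> \<open>The witnesses are the coefficients of (X - \<open>b m\<close>)(X -
      \<open>b n\<close>), which vanishes at the two unwanted nodes and takes the value
      \<open>r\<close> at \<open>b l\<close>.\<close>
    show "(b l - b m) * (b l - b n) \<noteq> 0" using inj[OF l mn(1,3)] inj[OF l mn(2,4)] by simp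
    show "(\<Sum>j<3. exp (\<alpha> * zeta j * of_real h) ^ 2 * E j)
        + (- b m - b n) * (\<Sum>j<3. exp (\<alpha> * zeta j * of_real h) * E j) + (b m * b n) * (\<Sum>j<3. E j)
        = (b l - b m) * (b l - b n) * E l" for E
      unfolding b_def[symmetric] S by (simp add: algebra_simps power2_eq_square)
  qed
qed

lemma exp_step_exists:
  fixes \<alpha> :: complex
  obtains h :: real where "0 < h" "norm (\<alpha> * of_real h) \<le> 1"
proof (rule that)
  have pos: "0 < norm \<alpha> + 1" using norm_ge_zero[of \<alpha>] by linarith
  then show "0 < 1 / (norm \<alpha> + 1)" by simp
  then have "norm (\<alpha> * of_real (1 / (norm \<alpha> + 1))) = norm \<alpha> / (norm \<alpha> + 1)"
    unfolding norm_mult norm_of_real by simp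
  also have "\<dots> \<le> 1" using pos by simp
  finally show "norm (\<alpha> * of_real (1 / (norm \<alpha> + 1))) \<le> 1" .
qed

text \<open>Sampling at 0, \<open>h\<close> and \<open>2 * h\<close> turns the vanishing sum into
  the three equations that \<open>exp_separation\<close> eliminates.\<close>

lemma exp_zeta_independent:
  assumes \<alpha>: "\<alpha> \<noteq> 0" and zero: "\<And>x. (\<Sum>l<3. c l * exp (\<alpha> * zeta l * of_real x)) = 0" and l: "l < 3"
  shows "c l = 0"
proof -
  obtain h where h: "0 < h" "norm (\<alpha> * of_real h) \<le> 1" by (rule exp_step_exists)
  obtain r p q where r: "r \<noteq> 0" and sep:
    "\<And>E. (\<Sum>j<3. exp (\<alpha> * zeta j * of_real h) ^ 2 * E j)
          + p * (\<Sum>j<3. exp (\<alpha> * zeta j * of_real h) * E j) + q * (\<Sum>j<3. E j) = r * E l"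
    using exp_separation[OF \<alpha> less_imp_neq[OF h(1), symmetric] h(2) l] by blast
  have "exp (\<alpha> * zeta j * of_real h) ^ 2 = exp (\<alpha> * zeta j * of_real (2 * h))" for j
    by (simp add: power2_eq_square algebra_simps flip: exp_add)
  then have "r * c l = 0"
    using sep[of c] zero[of 0] zero[of h] zero[of "2 * h"] by (simp add: mult.commute)
  then show ?thesis using r by simp
qed

section \<open>The kernel \<open>sigma\<close> as a sum of three separated exponentials\<close>

lemma sigma_eq:
  "sigma (\<alpha> * of_real (x - t)) =
     (\<Sum>l<3. exp (\<alpha> * zeta l * of_real x) * exp (- (\<alpha> * zeta l) * of_real t) / (3 * (zeta l)\<^sup>2))"
  unfolding sigma_def sum_distrib_left
  by (intro sum.cong refl) (simp add: algebra_simps flip: exp_add)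

text \<open>The integral equation only asserts integrability of a combination of three exponentials
  times \<open>g\<close>. Moving \<open>x\<close> by multiples of \<open>h\<close> gives three such
  combinations, and elimination isolates each exponential.\<close>

lemma exp_integrable_of_sigma:
  fixes g :: "real \<Rightarrow> complex"
  assumes \<alpha>: "\<alpha> \<noteq> 0" and h: "h \<noteq> 0" "norm (\<alpha> * of_real h) \<le> 1" and l: "l < 3"
    and int: "\<And>k::nat. k < 3 \<Longrightarrow>
      (\<lambda>t. sigma (\<alpha> * of_real (x + of_nat k * h - t)) * g t) absolutely_integrable_on S"
  shows "(\<lambda>t. exp (- (\<alpha> * zeta l) * of_real t) * g t) absolutely_integrable_on S"
proof -
  obtain r p q where r: "r \<noteq> 0" and sep:
    "\<And>E. (\<Sum>j<3. exp (\<alpha> * zeta j * of_real h) ^ 2 * E j)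
          + p * (\<Sum>j<3. exp (\<alpha> * zeta j * of_real h) * E j) + q * (\<Sum>j<3. E j) = r * E l"
    using exp_separation[OF \<alpha> h l] by blast
  define F where "F k t = sigma (\<alpha> * of_real (x + of_nat k * h - t)) * g t" for k :: nat and t
  define E where "E t j = exp (\<alpha> * zeta j * of_real x) * exp (- (\<alpha> * zeta j) * of_real t)
    / (3 * (zeta j)\<^sup>2) * g t" for t j
  have F: "F k t = (\<Sum>j<3. exp (\<alpha> * zeta j * of_real h) ^ k * E t j)" for k t
    unfolding F_def E_def sigma_eq sum_distrib_right
    by (intro sum.cong refl)
       (simp add: exp_of_nat_mult[symmetric] algebra_simps exp_add)
  \<comment> \<open>The \<open>x\<close>-dependent factor and the normalisation of mode
    \<open>l\<close> in \<open>sigma_eq\<close>, times the pivot \<open>r\<close> of the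
    elimination; it is nonzero and is divided out at the end.\<close>
  let ?c = "r * exp (\<alpha> * zeta l * of_real x) / (3 * (zeta l)\<^sup>2)"
  have "?c * (exp (- (\<alpha> * zeta l) * of_real t) * g t) = F 2 t + p * F 1 t + q * F 0 t" for t
    using sep[of "E t"] by (simp add: F E_def)
  moreover have "(\<lambda>t. F 2 t + p * F 1 t + q * F 0 t) absolutely_integrable_on S"
    using int unfolding F_def[symmetric] by (intro set_integral_add set_integrable_mult_right) auto
  ultimately have "(\<lambda>t. ?c * (exp (- (\<alpha> * zeta l) * of_real t) * g t)) absolutely_integrable_on S"
    by simp
  then have "(\<lambda>t. inverse ?c * (?c * (exp (- (\<alpha> * zeta l) * of_real t) * g t))) absolutely_integrable_on S"
    by (rule set_integrable_mult_right)
  moreover have "?c \<noteq> 0" using r zeta_nonzero[OF l] by simp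
  ultimately show ?thesis by (simp add: mult.assoc[symmetric])
qed

lemma integral_sigma_mult:
  fixes g :: "real \<Rightarrow> complex"
  assumes "\<And>l. l < 3 \<Longrightarrow> (\<lambda>t. exp (- (\<alpha> * zeta l) * of_real t) * g t) absolutely_integrable_on S"
  shows "integral S (\<lambda>t. sigma (\<alpha> * of_real (x - t)) * g t) =
    (\<Sum>l<3. exp (\<alpha> * zeta l * of_real x) / (3 * (zeta l)\<^sup>2)
      * integral S (\<lambda>t. exp (- (\<alpha> * zeta l) * of_real t) * g t))"
proof -
  have "((\<lambda>t. \<Sum>l<3. exp (\<alpha> * zeta l * of_real x) / (3 * (zeta l)\<^sup>2)
      * (exp (- (\<alpha> * zeta l) * of_real t) * g t)) has_integral
    (\<Sum>l<3. exp (\<alpha> * zeta l * of_real x) / (3 * (zeta l)\<^sup>2)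
      * integral S (\<lambda>t. exp (- (\<alpha> * zeta l) * of_real t) * g t))) S"
    using set_lebesgue_integral_eq_integral(1)[OF assms]
    by (intro has_integral_sum has_integral_mult_right integrable_integral) auto
  moreover have "(\<Sum>l<3. exp (\<alpha> * zeta l * of_real x) / (3 * (zeta l)\<^sup>2)
      * (exp (- (\<alpha> * zeta l) * of_real t) * g t)) = sigma (\<alpha> * of_real (x - t)) * g t" for t
    unfolding sigma_eq sum_distrib_right by (intro sum.cong refl) simp
  ultimately show ?thesis by (simp add: integral_unique)
qed

section \<open>Solutions and their exponential modes\<close>

text \<open>Naming the derivatives lets mode coefficients and brackets refer to them. A general
  coefficient \<open>f\<close> covers both the equation at \<open>\<mu>\<close> and the conjugate of
  the equation at \<open>cnj \<mu>\<close>.\<close>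

definition ode :: "(real \<Rightarrow> complex) \<Rightarrow> (real \<Rightarrow> complex) \<Rightarrow> (real \<Rightarrow> complex) \<Rightarrow> (real \<Rightarrow> complex) \<Rightarrow> bool"
  where "ode f y y' y'' \<longleftrightarrow>
    (\<forall>x. (y has_vector_derivative y' x) (at x)) \<and>
    (\<forall>x. (y' has_vector_derivative y'' x) (at x)) \<and>
    ac_deriv y'' (\<lambda>x. f x * y x)"

lemma odeD:
  assumes "ode f y y' y''"
  shows "(y has_vector_derivative y' x) (at x)" "(y' has_vector_derivative y'' x) (at x)"
    "ac_deriv y'' (\<lambda>x. f x * y x)" "continuous_on UNIV y'" "continuous_on UNIV y''"
    "ac_deriv y y'" "ac_deriv y' y''"
proof -
  show y: "(y has_vector_derivative y' x) (at x)" and y': "(y' has_vector_derivative y'' x) (at x)"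
    and y'': "ac_deriv y'' (\<lambda>x. f x * y x)" for x
    using assms unfolding ode_def by blast+
  show c': "continuous_on UNIV y'"
    by (meson continuous_at_imp_continuous_on y' has_vector_derivative_continuous)
  show c'': "continuous_on UNIV y''"
    by (rule ac_deriv_continuous[OF y''])
  show "ac_deriv y y'" by (rule ac_deriv_of_vector_derivative[OF y c'])
  show "ac_deriv y' y''" by (rule ac_deriv_of_vector_derivative[OF y' c''])
qed

lemma solves_eq_imp_ode:
  assumes "solves_eq m \<mu> y"
  obtains y' y'' where "ode (\<lambda>x. - \<i> * \<mu> ^ 3 * of_real (m x)) y y' y''"
proof -
  obtain y' y'' where
    d: "\<And>x. (y has_vector_derivative y' x) (at x)" "\<And>x. (y' has_vector_derivative y'' x) (at x)"
    and i: "\<And>c d. c \<le> d \<Longrightarrow> (\<lambda>x. of_real (m x) * \<mu> ^ 3 * y x) absolutely_integrable_on {c..d}"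
    and e: "\<And>c d. c \<le> d \<Longrightarrow>
      \<i> * (y'' d - y'' c) = integral {c..d} (\<lambda>x. of_real (m x) * \<mu> ^ 3 * y x)"
    using assms unfolding solves_eq_def by blast
  have "ac_deriv (\<lambda>x. \<i> * y'' x) (\<lambda>x. of_real (m x) * \<mu> ^ 3 * y x)"
    unfolding ac_deriv_def using i e by (simp add: right_diff_distrib)
  from ac_deriv_cmult[OF this, of "- \<i>"]
  have "ac_deriv y'' (\<lambda>x. - \<i> * \<mu> ^ 3 * of_real (m x) * y x)"
    by (rule ac_deriv_cong) (auto simp: algebra_simps)
  then show ?thesis using that d unfolding ode_def by blast
qed

lemma ode_cnj:
  assumes "ode f y y' y''"
  shows "ode (\<lambda>x. cnj (f x)) (\<lambda>x. cnj (y x)) (\<lambda>x. cnj (y' x)) (\<lambda>x. cnj (y'' x))"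
  using odeD(1-2)[OF assms] ac_deriv_cnj[OF odeD(3)[OF assms]] unfolding ode_def
  by (auto intro: bounded_linear.has_vector_derivative[OF bounded_linear_cnj])

text \<open>On differentiation the mixed terms cancel in pairs, and the third derivatives contribute
  \<open>f * y * w\<close> with opposite signs.\<close>

lemma ode_bracket_constant:
  assumes y: "ode f y y' y''" and w: "ode (\<lambda>x. - f x) w w' w''"
  shows "y'' a * w a - y' a * w' a + y a * w'' a = y'' b * w b - y' b * w' b + y b * w'' b"
proof -
  note y = odeD[OF y] and w = odeD[OF w]
  \<comment> \<open>The factors are ordered so that the one with a merely integrable derivative
    comes first, as \<open>ac_deriv_mult\<close> expects.\<close>
  have "ac_deriv (\<lambda>x. (y'' x * w x + w'' x * y x) + (- 1) * (y' x * w' x))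
     (\<lambda>x. ((f x * y x * w x + y'' x * w' x) + (- f x * w x * y x + w'' x * y' x))
          + (- 1) * (y'' x * w' x + y' x * w'' x))"
    by (intro ac_deriv_add ac_deriv_cmult ac_deriv_mult y w)
  then have "ac_deriv (\<lambda>x. y'' x * w x - y' x * w' x + y x * w'' x) (\<lambda>x. 0)"
    by (rule ac_deriv_cong) (auto simp: algebra_simps)
  then show ?thesis by (rule ac_deriv_zero_imp_constant)
qed

section \<open>Mode coefficients of a solution\<close>

definition mode_coef ::
    "complex \<Rightarrow> (real \<Rightarrow> complex) \<Rightarrow> (real \<Rightarrow> complex) \<Rightarrow> (real \<Rightarrow> complex) \<Rightarrow> real \<Rightarrow> complex"
  where "mode_coef \<beta> y y' y'' x = exp (- \<beta> * of_real x) * (y'' x + \<beta> * y' x + \<beta>\<^sup>2 * y x)"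

text \<open>With D = d/dx, the operator D^2 + \<beta> D + \<beta>^2 is the cofactor of D - \<beta>
  in D^3 - \<beta>^3. Differentiating after multiplication by \<open>exp (- \<beta> * x)\<close>
  applies D - \<beta>, which leaves only y''' - \<beta>^3 y.\<close>

lemma ac_deriv_coef:
  assumes "ode f y y' y''"
  shows "ac_deriv (mode_coef \<beta> y y' y'') (\<lambda>x. exp (- \<beta> * of_real x) * ((f x - \<beta> ^ 3) * y x))"
proof -
  note y = odeD[OF assms]
  have e: "((\<lambda>x. exp (- \<beta> * of_real x)) has_vector_derivative - \<beta> * exp (- \<beta> * of_real x)) (at x)"
    for x :: real
    by (rule has_vector_derivative_real_field) (auto intro!: derivative_eq_intros)
  have "ac_deriv (\<lambda>x. (y'' x + \<beta> * y' x + \<beta>\<^sup>2 * y x) * exp (- \<beta> * of_real x))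
    (\<lambda>x. (f x * y x + \<beta> * y'' x + \<beta>\<^sup>2 * y' x) * exp (- \<beta> * of_real x)
       + (y'' x + \<beta> * y' x + \<beta>\<^sup>2 * y x) * (- \<beta> * exp (- \<beta> * of_real x)))"
    by (intro ac_deriv_mult e ac_deriv_add ac_deriv_cmult y) (intro continuous_intros)
  then show ?thesis
    by (rule ac_deriv_cong)
       (auto simp: mode_coef_def algebra_simps power2_eq_square power3_eq_cube)
qed

text \<open>The cube roots of unity and their squares both sum to zero, so averaging extracts the
  constant term. This is used to recover both a solution and the bracket.\<close>

lemma sum_zeta_quadratic: "(\<Sum>l<3. (zeta l * a + (zeta l)\<^sup>2 * b + c) / 3) = c"
proof -
  have "(\<Sum>l<3. (zeta l * a + (zeta l)\<^sup>2 * b + c) / 3) = ((zeta 0 + zeta 1 + zeta 2) * a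
      + ((zeta 0)\<^sup>2 + (zeta 1)\<^sup>2 + (zeta 2)\<^sup>2) * b + 3 * c) / 3"
    unfolding sum_lessThan_3 by (simp add: algebra_simps add_divide_distrib)
  also have "(zeta 0)\<^sup>2 + (zeta 1)\<^sup>2 + (zeta 2)\<^sup>2 = 0"
    using zeta_1_square by (simp add: zeta_2 power2_eq_square algebra_simps)
  also have "zeta 0 + zeta 1 + zeta 2 = 0"
    by (simp add: zeta_2)
  finally show ?thesis by simp
qed

text \<open>Because \<open>1 / (zeta l)\<^sup>2 = zeta l\<close>, each summand is a quadratic in
  \<open>zeta l\<close> with constant term \<open>y x / 3\<close>: a discrete Fourier
  inversion.\<close>

lemma coef_inversion:
  assumes "\<alpha> \<noteq> 0"
  shows "y x = (\<Sum>l<3. exp (\<alpha> * zeta l * of_real x) * mode_coef (\<alpha> * zeta l) y y' y'' x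
    / (3 * (\<alpha> * zeta l)\<^sup>2))"
proof -
  have summand: "exp (\<alpha> * zeta l * of_real x) * mode_coef (\<alpha> * zeta l) y y' y'' x / (3 * (\<alpha> * zeta l)\<^sup>2)
      = (zeta l * (y'' x / \<alpha>\<^sup>2) + (zeta l)\<^sup>2 * (y' x / \<alpha>) + y x) / 3" if l: "l < 3" for l
  proof -
    have "exp (\<alpha> * zeta l * of_real x) * exp (- (\<alpha> * zeta l) * of_real x) = 1"
      by (simp flip: exp_add)
    then have "exp (\<alpha> * zeta l * of_real x) * mode_coef (\<alpha> * zeta l) y y' y'' x / (3 * (\<alpha> * zeta l)\<^sup>2)
      = (y'' x + (\<alpha> * zeta l) * y' x + (\<alpha> * zeta l)\<^sup>2 * y x) * (1 / (zeta l)\<^sup>2) / (3 * \<alpha>\<^sup>2)"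
      unfolding mode_coef_def mult.assoc[symmetric] by (simp add: power_mult_distrib)
    also have "\<dots> = (y'' x * zeta l + \<alpha> * (zeta l)\<^sup>2 * y' x + \<alpha>\<^sup>2 * zeta l ^ 3 * y x) / (3 * \<alpha>\<^sup>2)"
      unfolding inverse_zeta_square[OF l]
      by (simp add: algebra_simps power2_eq_square power3_eq_cube)
    also have "\<dots> = (zeta l * (y'' x / \<alpha>\<^sup>2) + (zeta l)\<^sup>2 * (y' x / \<alpha>) + y x) / 3"
      using assms unfolding zeta_cube[OF l] by (simp add: field_simps power2_eq_square)
    finally show ?thesis .
  qed
  have "(\<Sum>l<3. exp (\<alpha> * zeta l * of_real x) * mode_coef (\<alpha> * zeta l) y y' y'' x
      / (3 * (\<alpha> * zeta l)\<^sup>2))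
    = (\<Sum>l<3. (zeta l * (y'' x / \<alpha>\<^sup>2) + (zeta l)\<^sup>2 * (y' x / \<alpha>) + y x) / 3)"
    by (intro sum.cong refl summand) simp
  also have "\<dots> = y x" by (rule sum_zeta_quadratic)
  finally show ?thesis by simp
qed

text \<open>Coefficient and \<open>J l\<close> have the same derivative, hence differ by a constant;
  comparing \<open>coef_inversion\<close> with the integral equation, independence of the
  exponentials fixes the constants. \<open>J\<close> is left abstract so that both ends of the line
  are covered.\<close>

lemma coef_of_integral_equation:
  assumes \<alpha>: "\<alpha> \<noteq> 0" and j: "j < 3" and l: "l < 3" and ode: "ode f y y' y''"
    and J: "\<And>l. l < 3 \<Longrightarrow>
      ac_deriv (J l) (\<lambda>x. exp (- (\<alpha> * zeta l) * of_real x) * ((f x - \<alpha> ^ 3) * y x))"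
    and y: "\<And>x. y x = exp (\<alpha> * zeta j * of_real x)
      + (\<Sum>l<3. exp (\<alpha> * zeta l * of_real x) * J l x / (3 * (\<alpha> * zeta l)\<^sup>2))"
  shows "mode_coef (\<alpha> * zeta l) y y' y'' x = (if l = j then 3 * (\<alpha> * zeta l)\<^sup>2 else 0) + J l x"
proof -
  define K where "K l x = mode_coef (\<alpha> * zeta l) y y' y'' x - J l x" for l x
  have K: "K l x = K l 0" if "l < 3" for l x
  proof -
    have "ac_deriv (\<lambda>x. mode_coef (\<alpha> * zeta l) y y' y'' x + (- 1) * J l x) (\<lambda>x.
      exp (- (\<alpha> * zeta l) * of_real x) * ((f x - (\<alpha> * zeta l) ^ 3) * y x)
      + (- 1) * (exp (- (\<alpha> * zeta l) * of_real x) * ((f x - \<alpha> ^ 3) * y x)))"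
      by (intro ac_deriv_add ac_deriv_cmult ac_deriv_coef[OF ode] J that)
    then have "ac_deriv (K l) (\<lambda>x. 0)"
      by (rule ac_deriv_cong) (auto simp: K_def power_mult_distrib zeta_cube[OF that])
    then show ?thesis by (rule ac_deriv_zero_imp_constant)
  qed
  have nz: "3 * (\<alpha> * zeta l)\<^sup>2 \<noteq> 0" if "l < 3" for l
    using \<alpha> zeta_nonzero[OF that] by simp
  \<comment> \<open>The normalised constants minus their expected values; the goal is that all three
    vanish.\<close>
  define c where "c l = K l 0 / (3 * (\<alpha> * zeta l)\<^sup>2) - (if l = j then 1 else 0)" for l
  have "(\<Sum>l<3. c l * exp (\<alpha> * zeta l * of_real x)) = 0" for x
  proof -
    have "(\<Sum>l<3. K l 0 / (3 * (\<alpha> * zeta l)\<^sup>2) * exp (\<alpha> * zeta l * of_real x))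
      = (\<Sum>l<3. exp (\<alpha> * zeta l * of_real x) * mode_coef (\<alpha> * zeta l) y y' y'' x / (3 * (\<alpha> * zeta l)\<^sup>2)
           - exp (\<alpha> * zeta l * of_real x) * J l x / (3 * (\<alpha> * zeta l)\<^sup>2))"
    proof (intro sum.cong refl)
      fix l assume "l \<in> {..<3::nat}"
      then have "K l 0 = mode_coef (\<alpha> * zeta l) y y' y'' x - J l x" using K[of l x] by (simp add: K_def)
      then show "K l 0 / (3 * (\<alpha> * zeta l)\<^sup>2) * exp (\<alpha> * zeta l * of_real x)
        = exp (\<alpha> * zeta l * of_real x) * mode_coef (\<alpha> * zeta l) y y' y'' x / (3 * (\<alpha> * zeta l)\<^sup>2)
           - exp (\<alpha> * zeta l * of_real x) * J l x / (3 * (\<alpha> * zeta l)\<^sup>2)"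
        by (simp add: diff_divide_distrib right_diff_distrib mult.commute)
    qed
    also have "\<dots> = exp (\<alpha> * zeta j * of_real x)"
      unfolding sum_subtractf coef_inversion[OF \<alpha>, of y x y' y'', symmetric]
      using y[of x] by simp
    finally have 1: "(\<Sum>l<3. K l 0 / (3 * (\<alpha> * zeta l)\<^sup>2) * exp (\<alpha> * zeta l * of_real x))
      = exp (\<alpha> * zeta j * of_real x)" .
    have 2: "(\<Sum>l<3. (if l = j then 1 else 0) * exp (\<alpha> * zeta l * of_real x))
      = exp (\<alpha> * zeta j * of_real x)"
      using j by (simp add: if_distrib[of "\<lambda>a. a * _"] sum.delta cong: if_cong)
    show ?thesis unfolding c_def left_diff_distrib sum_subtractf 1 2 by simp
  qed
  from exp_zeta_independent[OF \<alpha> this l]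
  have "K l 0 = (if l = j then 3 * (\<alpha> * zeta l)\<^sup>2 else 0)"
    using nz[OF l] by (auto simp: c_def field_simps split: if_splits)
  then show ?thesis using K[OF l, of x] by (simp add: K_def diff_eq_eq split del: if_split)
qed

section \<open>Jost solutions and the scattering identity\<close>

text \<open>For \<alpha> = \<open>\<i> * zlim c \<mu>\<close>, the number \<alpha>^3 is the
  coefficient of the equation with \<open>m\<close> replaced by \<open>c\<close>; so the full
  coefficient minus \<alpha>^3 is \<alpha>^3 (m/c - 1), the perturbation in the integral
  equation.\<close>

lemma i_zlim_cube:
  assumes "0 < c"
  shows "(\<i> * zlim c \<mu>) ^ 3 = - \<i> * \<mu> ^ 3 * of_real c"
proof -
  have "of_real (root 3 c) ^ 3 = (of_real c :: complex)"
    using assms by (simp flip: of_real_power)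
  moreover have "\<i> ^ 3 = - \<i>" by (simp add: power3_eq_cube)
  ultimately show ?thesis by (simp add: zlim_def power_mult_distrib)
qed

lemma zlim_nonzero: "0 < c \<Longrightarrow> \<mu> \<noteq> 0 \<Longrightarrow> \<i> * zlim c \<mu> \<noteq> 0"
  by (simp add: zlim_def)

text \<open>The asymptotics of \<open>v\<close> alone cannot detect modes that decay at infinity, so
  the limits are taken from the integral equation: its integral, split into modes, is the vanishing
  part \<open>J\<close> of the coefficients.\<close>

lemma jost_plus_coef_tendsto:
  assumes jost: "jost_plus m c j \<mu> v" and c: "0 < c" and \<mu>: "\<mu> \<noteq> 0" and j: "j < 3" and l: "l < 3"
    and ode: "ode (\<lambda>x. - \<i> * \<mu> ^ 3 * of_real (m x)) v v' v''"
  shows "(mode_coef (\<i> * zlim c \<mu> * zeta l) v v' v'' \<longlongrightarrow>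
    (if l = j then 3 * (\<i> * zlim c \<mu> * zeta l)\<^sup>2 else 0)) at_top"
proof -
  define \<alpha> where "\<alpha> = \<i> * zlim c \<mu>"
  have \<alpha>: "\<alpha> \<noteq> 0" and \<alpha>3: "\<alpha> ^ 3 = - \<i> * \<mu> ^ 3 * of_real c"
    unfolding \<alpha>_def using zlim_nonzero[OF c \<mu>] i_zlim_cube[OF c] by auto
  define g where "g t = of_real (m t / c - 1) * v t" for t
  define E where "E l t = exp (- (\<alpha> * zeta l) * of_real t) * g t" for l t
  have int: "(\<lambda>t. sigma (\<alpha> * of_real (x - t)) * g t) absolutely_integrable_on {x..}"
    and eq: "v x = exp (\<alpha> * zeta j * of_real x)
      - \<alpha> * integral {x..} (\<lambda>t. sigma (\<alpha> * of_real (x - t)) * g t)" for x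
    using jost unfolding jost_plus_def wave_def \<alpha>_def g_def mult.assoc by blast+
  obtain h where h: "0 < h" "norm (\<alpha> * of_real h) \<le> 1" by (rule exp_step_exists)
  have E_int: "E l absolutely_integrable_on {x..}" if "l < 3" for l x
    unfolding E_def
  proof (rule exp_integrable_of_sigma[OF \<alpha> _ _ that])
    \<comment> \<open>The shift is to the left, so that \<open>{x..}\<close> lies inside each
      half-line on which the shifted kernel is known to be integrable.\<close>
    show "- h \<noteq> 0" "norm (\<alpha> * of_real (- h)) \<le> 1" using h by auto
    show "(\<lambda>t. sigma (\<alpha> * of_real (x + of_nat k * - h - t)) * g t) absolutely_integrable_on {x..}"
      for k :: nat
      by (rule set_integrable_subset[OF int]) (use h in auto)
  qed
  \<comment> \<open>The factor \<open>\<alpha> ^ 3\<close> gives the derivative required of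
    \<open>J l\<close>; divided by \<open>3 * (\<alpha> * zeta l)\<^sup>2\<close> it leaves the
    single \<open>\<alpha>\<close> in front of the integral in the Jost equation.\<close>
  define J where "J l x = \<alpha> ^ 3 * - integral {x..} (E l)" for l x
  have coef_eq: "mode_coef (\<alpha> * zeta l) v v' v'' x = (if l = j then 3 * (\<alpha> * zeta l)\<^sup>2 else 0) + J l x" for x
  proof (rule coef_of_integral_equation[OF \<alpha> j l ode])
    fix l :: nat assume "l < 3"
    have "ac_deriv (J l) (\<lambda>x. \<alpha> ^ 3 * E l x)"
      unfolding J_def by (intro ac_deriv_cmult tail_integral_at_top E_int \<open>l < 3\<close>)
    then show "ac_deriv (J l) (\<lambda>x. exp (- (\<alpha> * zeta l) * of_real x)
        * ((- \<i> * \<mu> ^ 3 * of_real (m x) - \<alpha> ^ 3) * v x))"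
      by (rule ac_deriv_cong) (use c in \<open>auto simp: E_def g_def \<alpha>3 field_simps\<close>)
  next
    fix x
    have sig: "integral {x..} (\<lambda>t. sigma (\<alpha> * of_real (x - t)) * g t)
      = (\<Sum>l<3. exp (\<alpha> * zeta l * of_real x) / (3 * (zeta l)\<^sup>2) * integral {x..} (E l))"
      using integral_sigma_mult[OF E_int[unfolded E_def]] by (simp only: E_def[abs_def])
    have step: "exp (\<alpha> * zeta l * of_real x) * J l x / (3 * (\<alpha> * zeta l)\<^sup>2)
      = - \<alpha> * (exp (\<alpha> * zeta l * of_real x) / (3 * (zeta l)\<^sup>2) * integral {x..} (E l))" for l
      using \<alpha> unfolding J_def by (simp add: field_simps power2_eq_square power3_eq_cube)
    have "(\<Sum>l<3. exp (\<alpha> * zeta l * of_real x) * J l x / (3 * (\<alpha> * zeta l)\<^sup>2))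
      = - \<alpha> * integral {x..} (\<lambda>t. sigma (\<alpha> * of_real (x - t)) * g t)"
      unfolding sig by (simp only: step sum_distrib_left)
    then show "v x = exp (\<alpha> * zeta j * of_real x)
      + (\<Sum>l<3. exp (\<alpha> * zeta l * of_real x) * J l x / (3 * (\<alpha> * zeta l)\<^sup>2))"
      using eq[of x] by simp
  qed
  have "(J l \<longlongrightarrow> \<alpha> ^ 3 * 0) at_top"
    unfolding J_def by (intro tendsto_mult_left tail_integral_at_top E_int l)
  then have "((\<lambda>x. (if l = j then 3 * (\<alpha> * zeta l)\<^sup>2 else 0) + J l x) \<longlongrightarrow>
      (if l = j then 3 * (\<alpha> * zeta l)\<^sup>2 else 0) + 0) at_top"
    by (intro tendsto_add tendsto_const) simp
  then show ?thesis
    unfolding \<alpha>_def[symmetric] coef_eq[symmetric] by simp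
qed

text \<open>The mirror image of \<open>jost_plus_coef_tendsto\<close>: the half-lines are
  \<open>{..x}\<close>, so the shift \<open>h\<close> goes to the right and \<open>J\<close> carries
  no minus sign.\<close>

lemma jost_minus_coef_tendsto:
  assumes jost: "jost_minus m c j \<mu> u" and c: "0 < c" and \<mu>: "\<mu> \<noteq> 0" and j: "j < 3" and l: "l < 3"
    and ode: "ode (\<lambda>x. - \<i> * \<mu> ^ 3 * of_real (m x)) u u' u''"
  shows "(mode_coef (\<i> * zlim c \<mu> * zeta l) u u' u'' \<longlongrightarrow>
    (if l = j then 3 * (\<i> * zlim c \<mu> * zeta l)\<^sup>2 else 0)) at_bot"
proof -
  define \<alpha> where "\<alpha> = \<i> * zlim c \<mu>"
  have \<alpha>: "\<alpha> \<noteq> 0" and \<alpha>3: "\<alpha> ^ 3 = - \<i> * \<mu> ^ 3 * of_real c"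
    unfolding \<alpha>_def using zlim_nonzero[OF c \<mu>] i_zlim_cube[OF c] by auto
  define g where "g t = of_real (m t / c - 1) * u t" for t
  define E where "E l t = exp (- (\<alpha> * zeta l) * of_real t) * g t" for l t
  have int: "(\<lambda>t. sigma (\<alpha> * of_real (x - t)) * g t) absolutely_integrable_on {..x}"
    and eq: "u x = exp (\<alpha> * zeta j * of_real x)
      + \<alpha> * integral {..x} (\<lambda>t. sigma (\<alpha> * of_real (x - t)) * g t)" for x
    using jost unfolding jost_minus_def wave_def \<alpha>_def g_def mult.assoc by blast+
  obtain h where h: "0 < h" "norm (\<alpha> * of_real h) \<le> 1" by (rule exp_step_exists)
  have E_int: "E l absolutely_integrable_on {..x}" if "l < 3" for l x
    unfolding E_def
  proof (rule exp_integrable_of_sigma[OF \<alpha> _ h(2) that])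
    show "h \<noteq> 0" using h by auto
    show "(\<lambda>t. sigma (\<alpha> * of_real (x + of_nat k * h - t)) * g t) absolutely_integrable_on {..x}"
      for k :: nat
      by (rule set_integrable_subset[OF int]) (use h in auto)
  qed
  define J where "J l x = \<alpha> ^ 3 * integral {..x} (E l)" for l x
  have coef_eq: "mode_coef (\<alpha> * zeta l) u u' u'' x = (if l = j then 3 * (\<alpha> * zeta l)\<^sup>2 else 0) + J l x" for x
  proof (rule coef_of_integral_equation[OF \<alpha> j l ode])
    fix l :: nat assume "l < 3"
    have "ac_deriv (J l) (\<lambda>x. \<alpha> ^ 3 * E l x)"
      unfolding J_def by (intro ac_deriv_cmult tail_integral_at_bot E_int \<open>l < 3\<close>)
    then show "ac_deriv (J l) (\<lambda>x. exp (- (\<alpha> * zeta l) * of_real x)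
        * ((- \<i> * \<mu> ^ 3 * of_real (m x) - \<alpha> ^ 3) * u x))"
      by (rule ac_deriv_cong) (use c in \<open>auto simp: E_def g_def \<alpha>3 field_simps\<close>)
  next
    fix x
    have sig: "integral {..x} (\<lambda>t. sigma (\<alpha> * of_real (x - t)) * g t)
      = (\<Sum>l<3. exp (\<alpha> * zeta l * of_real x) / (3 * (zeta l)\<^sup>2) * integral {..x} (E l))"
      using integral_sigma_mult[OF E_int[unfolded E_def]] by (simp only: E_def[abs_def])
    have step: "exp (\<alpha> * zeta l * of_real x) * J l x / (3 * (\<alpha> * zeta l)\<^sup>2)
      = \<alpha> * (exp (\<alpha> * zeta l * of_real x) / (3 * (zeta l)\<^sup>2) * integral {..x} (E l))" for l
      using \<alpha> unfolding J_def by (simp add: field_simps power2_eq_square power3_eq_cube)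
    have "(\<Sum>l<3. exp (\<alpha> * zeta l * of_real x) * J l x / (3 * (\<alpha> * zeta l)\<^sup>2))
      = \<alpha> * integral {..x} (\<lambda>t. sigma (\<alpha> * of_real (x - t)) * g t)"
      unfolding sig by (simp only: step sum_distrib_left)
    then show "u x = exp (\<alpha> * zeta j * of_real x)
      + (\<Sum>l<3. exp (\<alpha> * zeta l * of_real x) * J l x / (3 * (\<alpha> * zeta l)\<^sup>2))"
      using eq[of x] by simp
  qed
  have "(J l \<longlongrightarrow> \<alpha> ^ 3 * 0) at_bot"
    unfolding J_def by (intro tendsto_mult_left tail_integral_at_bot E_int l)
  then have "((\<lambda>x. (if l = j then 3 * (\<alpha> * zeta l)\<^sup>2 else 0) + J l x) \<longlongrightarrow>
      (if l = j then 3 * (\<alpha> * zeta l)\<^sup>2 else 0) + 0) at_bot"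
    by (intro tendsto_add tendsto_const) simp
  then show ?thesis
    unfolding \<alpha>_def[symmetric] coef_eq[symmetric] by simp
qed

text \<open>The exponentials for \<open>\<alpha> * zeta l\<close> and its negative cancel. What
  remains is a product of two quadratics in \<open>zeta l\<close>, which
  \<open>sum_zeta_quadratic\<close> averages to its constant term, the bracket.\<close>

lemma bracket_eq_sum_coef:
  assumes "\<alpha> \<noteq> 0"
  shows "y'' x * w x - y' x * w' x + y x * w'' x =
    (\<Sum>l<3. mode_coef (\<alpha> * zeta l) y y' y'' x * mode_coef (- (\<alpha> * zeta l)) w w' w'' x / (3 * (\<alpha> * zeta l)\<^sup>2))"
proof -
  \<comment> \<open>After division by \<open>(\<alpha> * zeta l)\<^sup>2\<close> and reduction by
    \<open>zeta l ^ 3 = 1\<close>, the product has \<open>?a\<close>, \<open>?b\<close>,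
    \<open>?c\<close> as coefficients of \<open>zeta l\<close>, its square and 1.\<close>
  let ?a = "y'' x * w'' x / \<alpha>\<^sup>2 + \<alpha> * (y' x * w x - y x * w' x)"
  let ?b = "(y' x * w'' x - y'' x * w' x) / \<alpha> + \<alpha>\<^sup>2 * (y x * w x)"
  let ?c = "y'' x * w x - y' x * w' x + y x * w'' x"
  have "mode_coef (\<alpha> * zeta l) y y' y'' x * mode_coef (- (\<alpha> * zeta l)) w w' w'' x / (3 * (\<alpha> * zeta l)\<^sup>2)
      = (zeta l * ?a + (zeta l)\<^sup>2 * ?b + ?c) / 3" if l: "l < 3" for l
  proof -
    let ?z = "zeta l"
    have z3: "?z ^ 3 = 1" and z0: "?z \<noteq> 0" using zeta_cube[OF l] zeta_nonzero[OF l] by auto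
    have "exp (- (\<alpha> * ?z) * of_real x) * exp (- (- (\<alpha> * ?z)) * of_real x) = 1"
      by (simp flip: exp_add)
    then have "mode_coef (\<alpha> * ?z) y y' y'' x * mode_coef (- (\<alpha> * ?z)) w w' w'' x
      = (y'' x + \<alpha> * ?z * y' x + (\<alpha> * ?z)\<^sup>2 * y x) * (w'' x - \<alpha> * ?z * w' x + (\<alpha> * ?z)\<^sup>2 * w x)"
      unfolding mode_coef_def by (simp add: algebra_simps)
    also have "\<dots> = (?z * ?a + ?z\<^sup>2 * ?b + ?c) * (\<alpha> * ?z)\<^sup>2"
    proof -
      have "?a * \<alpha>\<^sup>2 = y'' x * w'' x + \<alpha> ^ 3 * (y' x * w x - y x * w' x)"
        "?b * \<alpha>\<^sup>2 = \<alpha> * (y' x * w'' x - y'' x * w' x) + \<alpha> ^ 4 * (y x * w x)"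
        using assms by (auto simp: field_simps power2_eq_square eval_nat_numeral)
      then show ?thesis using z3 by algebra
    qed
    finally show ?thesis using assms z0 by simp
  qed
  then have "(\<Sum>l<3. mode_coef (\<alpha> * zeta l) y y' y'' x * mode_coef (- (\<alpha> * zeta l)) w w' w'' x
      / (3 * (\<alpha> * zeta l)\<^sup>2)) = (\<Sum>l<3. (zeta l * ?a + (zeta l)\<^sup>2 * ?b + ?c) / 3)"
    by (intro sum.cong refl) auto
  then show ?thesis unfolding sum_zeta_quadratic by simp
qed

section \<open>Conjugation and the limits of the bracket at both ends\<close>

lemma coef_cnj:
  "mode_coef (cnj \<beta>) (\<lambda>x. cnj (y x)) (\<lambda>x. cnj (y' x)) (\<lambda>x. cnj (y'' x)) x = cnj (mode_coef \<beta> y y' y'' x)"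
  by (simp add: mode_coef_def exp_cnj)

lemma cnj_i_zlim: "cnj (\<i> * zlim c (cnj \<mu>) * z) = - (\<i> * zlim c \<mu> * cnj z)"
  by (simp add: zlim_def)

text \<open>Conjugation exchanges \<open>zeta 1\<close> and \<open>zeta 2\<close>, so mode 1 of
  \<open>y\<close> meets mode 2 of \<open>w\<close> and conversely; the weights are the squares of
  \<open>zeta l\<close>. The filter is arbitrary so as to serve both ends.\<close>

lemma bracket_tendsto:
  assumes \<alpha>: "\<i> * zlim c \<mu> \<noteq> 0"
    and y: "\<And>l. l < 3 \<Longrightarrow>
      (mode_coef (\<i> * zlim c \<mu> * zeta l) y y' y'' \<longlongrightarrow> 3 * (\<i> * zlim c \<mu> * zeta l)\<^sup>2 * p l) F"
    and w: "\<And>l. l < 3 \<Longrightarrow>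
      (mode_coef (\<i> * zlim c (cnj \<mu>) * zeta l) w w' w'' \<longlongrightarrow> 3 * (\<i> * zlim c (cnj \<mu>) * zeta l)\<^sup>2 * q l) F"
  shows "((\<lambda>x. y'' x * cnj (w x) - y' x * cnj (w' x) + y x * cnj (w'' x)) \<longlongrightarrow>
    3 * (\<i> * zlim c \<mu>)\<^sup>2 * (p 0 * cnj (q 0) + zeta 2 * p 1 * cnj (q 2) + zeta 1 * p 2 * cnj (q 1))) F"
proof -
  define \<alpha> where "\<alpha> = \<i> * zlim c \<mu>"
  have \<alpha>: "\<alpha> \<noteq> 0" using assms(1) by (simp add: \<alpha>_def)
  let ?w = "\<lambda>x. cnj (w x)" and ?w' = "\<lambda>x. cnj (w' x)" and ?w'' = "\<lambda>x. cnj (w'' x)"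
  have lim: "(mode_coef (- (\<alpha> * zeta l)) ?w ?w' ?w'' \<longlongrightarrow> 3 * (\<alpha> * zeta l)\<^sup>2 * cnj (q k)) F"
    if k: "k < 3" and kl: "cnj (zeta k) = zeta l" for k l
  proof -
    have c: "cnj (\<i> * zlim c (cnj \<mu>) * zeta k) = - (\<alpha> * zeta l)"
      unfolding cnj_i_zlim kl \<alpha>_def ..
    have "((\<lambda>x. cnj (mode_coef (\<i> * zlim c (cnj \<mu>) * zeta k) w w' w'' x)) \<longlongrightarrow>
        cnj (3 * (\<i> * zlim c (cnj \<mu>) * zeta k)\<^sup>2 * q k)) F"
      by (intro tendsto_cnj w k)
    then show ?thesis
      unfolding coef_cnj[symmetric] complex_cnj_mult[of _ "q k"] complex_cnj_mult[of 3]
        complex_cnj_power c by simp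
  qed
  \<comment> \<open>The nested conditional is the permutation of the indices that conjugation
    induces on the roots of unity.\<close>
  have "((\<lambda>x. \<Sum>l<3. mode_coef (\<alpha> * zeta l) y y' y'' x * mode_coef (- (\<alpha> * zeta l)) ?w ?w' ?w'' x
      / (3 * (\<alpha> * zeta l)\<^sup>2)) \<longlongrightarrow>
      (\<Sum>l<3. 3 * (\<alpha> * zeta l)\<^sup>2 * p l
        * (3 * (\<alpha> * zeta l)\<^sup>2 * cnj (q (if l = 0 then 0 else if l = 1 then 2 else 1)))
      / (3 * (\<alpha> * zeta l)\<^sup>2))) F"
  proof (intro tendsto_sum tendsto_divide tendsto_mult tendsto_const)
    fix l :: nat assume "l \<in> {..<3}"
    then have l: "l < 3" by simp
    show "(mode_coef (\<alpha> * zeta l) y y' y'' \<longlongrightarrow> 3 * (\<alpha> * zeta l)\<^sup>2 * p l) F"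
      using y[OF l] by (simp add: \<alpha>_def)
    show "(mode_coef (- (\<alpha> * zeta l)) ?w ?w' ?w'' \<longlongrightarrow>
        3 * (\<alpha> * zeta l)\<^sup>2 * cnj (q (if l = 0 then 0 else if l = 1 then 2 else 1))) F"
      using l lim[of 0 0] lim[of 2 1] lim[of 1 2] by (elim less_3_cases) (simp_all add: cnj_zeta_1 cnj_zeta_2 del: One_nat_def)
    show "3 * (\<alpha> * zeta l)\<^sup>2 \<noteq> 0" using \<alpha> zeta_nonzero[OF l] by simp
  qed
  moreover have "(\<Sum>l<3. 3 * (\<alpha> * zeta l)\<^sup>2 * p l
        * (3 * (\<alpha> * zeta l)\<^sup>2 * cnj (q (if l = 0 then 0 else if l = 1 then 2 else 1)))
      / (3 * (\<alpha> * zeta l)\<^sup>2))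
    = 3 * \<alpha>\<^sup>2 * (p 0 * cnj (q 0) + zeta 2 * p 1 * cnj (q 2) + zeta 1 * p 2 * cnj (q 1))"
  proof -
    have sq: "(zeta 1)\<^sup>2 = zeta 2" "(zeta 2)\<^sup>2 = zeta 1"
      using zeta_1_square by (auto simp: zeta_2 power2_eq_square algebra_simps)
    have cancel: "3 * (\<alpha> * zeta l)\<^sup>2 * a * (3 * (\<alpha> * zeta l)\<^sup>2 * b) / (3 * (\<alpha> * zeta l)\<^sup>2)
      = 3 * \<alpha>\<^sup>2 * ((zeta l)\<^sup>2 * a * b)" if "l < 3" for l a b
      using \<alpha> zeta_nonzero[OF that] by (simp add: power_mult_distrib)
    have "(\<Sum>l<3. 3 * (\<alpha> * zeta l)\<^sup>2 * p l
        * (3 * (\<alpha> * zeta l)\<^sup>2 * cnj (q (if l = 0 then 0 else if l = 1 then 2 else 1)))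
      / (3 * (\<alpha> * zeta l)\<^sup>2))
      = (\<Sum>l<3. 3 * \<alpha>\<^sup>2 * ((zeta l)\<^sup>2 * p l * cnj (q (if l = 0 then 0 else if l = 1 then 2 else 1))))"
      by (intro sum.cong refl cancel) simp
    also have "\<dots> = 3 * \<alpha>\<^sup>2
        * (p 0 * cnj (q 0) + zeta 2 * p 1 * cnj (q 2) + zeta 1 * p 2 * cnj (q 1))"
      by (simp add: sum_lessThan_3 sq distrib_left del: One_nat_def)
    finally show ?thesis .
  qed
  moreover have "(\<lambda>x. y'' x * cnj (w x) - y' x * cnj (w' x) + y x * cnj (w'' x))
    = (\<lambda>x. \<Sum>l<3. mode_coef (\<alpha> * zeta l) y y' y'' x * mode_coef (- (\<alpha> * zeta l)) ?w ?w' ?w'' x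
      / (3 * (\<alpha> * zeta l)\<^sup>2))"
    by (rule ext) (rule bracket_eq_sum_coef[OF \<alpha>])
  ultimately show ?thesis
    by (simp only: \<alpha>_def)
qed

text \<open>Mode coefficients are linear in the solution, and at plus infinity the
  \<open>j\<close>-th Jost solution contributes to mode \<open>j\<close> only.\<close>

lemma transition_coef_tendsto:
  assumes v: "\<And>j. j < 3 \<Longrightarrow> jost_plus m c j \<mu> (v j)" and c: "0 < c" and \<mu>: "\<mu> \<noteq> 0" and l: "l < 3"
    and u: "\<And>x. u x = (\<Sum>j<3. t j * v j x)"
    and ode: "ode (\<lambda>x. - \<i> * \<mu> ^ 3 * of_real (m x)) u u' u''"
  shows "(mode_coef (\<i> * zlim c \<mu> * zeta l) u u' u'' \<longlongrightarrow> 3 * (\<i> * zlim c \<mu> * zeta l)\<^sup>2 * t l) at_top"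
proof -
  define \<beta> where "\<beta> = \<i> * zlim c \<mu> * zeta l"
  have "\<exists>v' v''. ode (\<lambda>x. - \<i> * \<mu> ^ 3 * of_real (m x)) (v j) v' v''" if "j < 3" for j
    using v[OF that] solves_eq_imp_ode unfolding jost_plus_def by metis
  then obtain v' v'' where ode_v:
    "\<And>j. j < 3 \<Longrightarrow> ode (\<lambda>x. - \<i> * \<mu> ^ 3 * of_real (m x)) (v j) (v' j) (v'' j)"
    by metis
  \<comment> \<open>\<open>u'\<close> and \<open>u''\<close> come from the hypothesis on
    \<open>u\<close> and not from the sum; uniqueness of derivatives identifies them with the
    combinations of those of \<open>v j\<close>.\<close>
  have u': "u' x = (\<Sum>j<3. t j * v' j x)" for x
  proof (rule vector_derivative_unique_at[OF odeD(1)[OF ode]])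
    have "((\<lambda>x. \<Sum>j<3. t j * v j x) has_vector_derivative (\<Sum>j<3. t j * v' j x)) (at x)"
      by (intro has_vector_derivative_sum has_vector_derivative_mult_right)
         (auto intro: odeD(1) ode_v)
    then show "(u has_vector_derivative (\<Sum>j<3. t j * v' j x)) (at x)"
      by (simp add: u[abs_def])
  qed
  have u'': "u'' x = (\<Sum>j<3. t j * v'' j x)" for x
  proof (rule vector_derivative_unique_at[OF odeD(2)[OF ode]])
    have "((\<lambda>x. \<Sum>j<3. t j * v' j x) has_vector_derivative (\<Sum>j<3. t j * v'' j x)) (at x)"
      by (intro has_vector_derivative_sum has_vector_derivative_mult_right)
         (auto intro: odeD(2) ode_v)
    then show "(u' has_vector_derivative (\<Sum>j<3. t j * v'' j x)) (at x)"
      by (simp add: u'[abs_def])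
  qed
  have "mode_coef \<beta> u u' u'' = (\<lambda>x. \<Sum>j<3. t j * mode_coef \<beta> (v j) (v' j) (v'' j) x)"
    unfolding fun_eq_iff mode_coef_def u u' u'' sum_lessThan_3 by (simp add: algebra_simps)
  moreover have "((\<lambda>x. \<Sum>j<3. t j * mode_coef \<beta> (v j) (v' j) (v'' j) x) \<longlongrightarrow>
    (\<Sum>j<3. t j * (if l = j then 3 * \<beta>\<^sup>2 else 0))) at_top"
    unfolding \<beta>_def
    by (intro tendsto_sum tendsto_mult_left jost_plus_coef_tendsto[OF v c \<mu> _ l ode_v]) auto
  moreover have "(\<Sum>j<3. t j * (if l = j then 3 * \<beta>\<^sup>2 else 0)) = 3 * \<beta>\<^sup>2 * t l"
    using l by (simp add: if_distrib[of "\<lambda>a. _ * a"] mult.commute cong: if_cong)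
  ultimately show ?thesis
    unfolding \<beta>_def[symmetric] by simp
qed

text \<open>The unitarity identity before division by \<open>p 0 * cnj (q 0)\<close>. The bracket of
  \<open>u\<close> and the conjugate of \<open>y\<close> has equal limits at both ends, and the
  common factor \<open>3 * (\<i> * \<mu>)\<^sup>2\<close> cancels.\<close>

lemma scattering_identity:
  assumes mp: "0 < mp" and mm: "0 < mm" and \<mu>: "\<mu> \<noteq> 0"
    and v: "\<And>j. j < 3 \<Longrightarrow> jost_plus m mp j \<mu> (v j)"
    and w: "\<And>j. j < 3 \<Longrightarrow> jost_plus m mp j (cnj \<mu>) (w j)"
    and u: "jost_minus m mm 0 \<mu> u" and y: "jost_minus m mm 0 (cnj \<mu>) y"
    and p: "\<And>x. u x = (\<Sum>j<3. p j * v j x)"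
    and q: "\<And>x. y x = (\<Sum>j<3. q j * w j x)"
  shows "of_real ((root 3 mm)\<^sup>2) = of_real ((root 3 mp)\<^sup>2) *
    (p 0 * cnj (q 0) + zeta 2 * p 1 * cnj (q 2) + zeta 1 * p 2 * cnj (q 1))"
proof -
  have \<mu>': "cnj \<mu> \<noteq> 0" using \<mu> by simp
  obtain u' u'' where ode_u: "ode (\<lambda>x. - \<i> * \<mu> ^ 3 * of_real (m x)) u u' u''"
    using u solves_eq_imp_ode unfolding jost_minus_def by blast
  obtain y' y'' where ode_y: "ode (\<lambda>x. - \<i> * cnj \<mu> ^ 3 * of_real (m x)) y y' y''"
    using y solves_eq_imp_ode unfolding jost_minus_def by blast
  \<comment> \<open>As \<open>m\<close> is real, conjugating the coefficient at
    \<open>cnj \<mu>\<close> gives the negative of the coefficient at \<open>\<mu>\<close>, as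
    \<open>ode_bracket_constant\<close> demands.\<close>
  have ode_cnj_y: "ode (\<lambda>x. - (- \<i> * \<mu> ^ 3 * of_real (m x)))
      (\<lambda>x. cnj (y x)) (\<lambda>x. cnj (y' x)) (\<lambda>x. cnj (y'' x))"
    using ode_cnj[OF ode_y] by simp
  define B where "B x = u'' x * cnj (y x) - u' x * cnj (y' x) + u x * cnj (y'' x)" for x
  have "B x = B 0" for x
    unfolding B_def by (rule ode_bracket_constant[OF ode_u ode_cnj_y])
  then have const: "B = (\<lambda>x. B 0)" by blast
  have top: "(B \<longlongrightarrow> 3 * (\<i> * zlim mp \<mu>)\<^sup>2
      * (p 0 * cnj (q 0) + zeta 2 * p 1 * cnj (q 2) + zeta 1 * p 2 * cnj (q 1))) at_top"
    unfolding B_def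
    by (intro bracket_tendsto zlim_nonzero mp \<mu>
        transition_coef_tendsto[OF v mp \<mu> _ p ode_u] transition_coef_tendsto[OF w mp \<mu>' _ q ode_y])
  \<comment> \<open>At minus infinity both solutions consist of mode 0 alone, so only the first
    product survives in the limit.\<close>
  let ?\<delta> = "\<lambda>l::nat. if l = 0 then 1 else 0 :: complex"
  have bot: "(B \<longlongrightarrow> 3 * (\<i> * zlim mm \<mu>)\<^sup>2
      * (?\<delta> 0 * cnj (?\<delta> 0) + zeta 2 * ?\<delta> 1 * cnj (?\<delta> 2) + zeta 1 * ?\<delta> 2 * cnj (?\<delta> 1))) at_bot"
    unfolding B_def
  proof (rule bracket_tendsto[OF zlim_nonzero[OF mm \<mu>]])
    fix l :: nat assume l: "l < 3"
    show "(mode_coef (\<i> * zlim mm \<mu> * zeta l) u u' u'' \<longlongrightarrow>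
        3 * (\<i> * zlim mm \<mu> * zeta l)\<^sup>2 * ?\<delta> l) at_bot"
      using jost_minus_coef_tendsto[OF u mm \<mu> _ l ode_u] by (cases "l = 0") auto
    show "(mode_coef (\<i> * zlim mm (cnj \<mu>) * zeta l) y y' y'' \<longlongrightarrow>
        3 * (\<i> * zlim mm (cnj \<mu>) * zeta l)\<^sup>2 * ?\<delta> l) at_bot"
      using jost_minus_coef_tendsto[OF y mm \<mu>' _ l ode_y] by (cases "l = 0") auto
  qed
  have "B 0 = 3 * (\<i> * zlim mp \<mu>)\<^sup>2
      * (p 0 * cnj (q 0) + zeta 2 * p 1 * cnj (q 2) + zeta 1 * p 2 * cnj (q 1))"
    using top by (subst (asm) const) (simp add: tendsto_const_iff)
  moreover have "B 0 = 3 * (\<i> * zlim mm \<mu>)\<^sup>2"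
    using bot by (subst (asm) const) (simp add: tendsto_const_iff)
  ultimately show ?thesis
    using \<mu> by (simp add: zlim_def power_mult_distrib)
qed

text \<open>The set \<open>\<Lambda>\<close> of spectral parameters is closed under conjugation so
  that \<open>conj_plus\<close> stays within it. The waves themselves need not converge, so each
  asymptotic relation says that a difference tends to zero.\<close>

theorem mainTheorem3:
  fixes m :: "real \<Rightarrow> real" and mp mm a k :: real
    and \<Lambda> :: "complex set"
    and u v :: "nat \<Rightarrow> complex \<Rightarrow> real \<Rightarrow> complex"
    and t :: "nat \<Rightarrow> nat \<Rightarrow> complex \<Rightarrow> complex"
    and r\<^sub>0 s\<^sub>1 s\<^sub>2 :: "complex \<Rightarrow> complex"
  assumes m: "admissible m mp mm a"
    and k: "k = root 3 mm / root 3 mp"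
    and \<Lambda>_nonzero: "0 \<notin> \<Lambda>"
    and \<Lambda>_conj: "\<And>\<mu>. \<mu> \<in> \<Lambda> \<Longrightarrow> cnj \<mu> \<in> \<Lambda>"
    and v: "\<And>\<mu> j. \<mu> \<in> \<Lambda> \<Longrightarrow> j < 3 \<Longrightarrow> jost_plus m mp j \<mu> (v j \<mu>)"
    and u: "\<And>\<mu> j. \<mu> \<in> \<Lambda> \<Longrightarrow> j < 3 \<Longrightarrow> jost_minus m mm j \<mu> (u j \<mu>)"
    and t: "\<And>\<mu> j x. \<mu> \<in> \<Lambda> \<Longrightarrow> j < 3 \<Longrightarrow> u j \<mu> x = (\<Sum>l<3. t j l \<mu> * v l \<mu> x)"
    and r\<^sub>0: "r\<^sub>0 = (\<lambda>\<mu>. 1 / t 0 0 \<mu>)"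
    and s\<^sub>1: "s\<^sub>1 = (\<lambda>\<mu>. t 0 1 \<mu> / t 0 0 \<mu>)"
    and s\<^sub>2: "s\<^sub>2 = (\<lambda>\<mu>. t 0 2 \<mu> / t 0 0 \<mu>)"
  shows "\<forall>\<mu>\<in>\<Lambda>. t 0 0 \<mu> \<noteq> 0 \<longrightarrow>
      (\<forall>x. r\<^sub>0 \<mu> * u 0 \<mu> x = v 0 \<mu> x + s\<^sub>1 \<mu> * v 1 \<mu> x + s\<^sub>2 \<mu> * v 2 \<mu> x) \<and>
      ((\<lambda>x. r\<^sub>0 \<mu> * u 0 \<mu> x
            - (wave mp 0 \<mu> x + s\<^sub>1 \<mu> * wave mp 1 \<mu> x + s\<^sub>2 \<mu> * wave mp 2 \<mu> x)) \<longlongrightarrow> 0) at_top \<and>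
      ((\<lambda>x. r\<^sub>0 \<mu> * u 0 \<mu> x - r\<^sub>0 \<mu> * wave mm 0 \<mu> x) \<longlongrightarrow> 0) at_bot \<and>
      (t 0 0 (cnj \<mu>) \<noteq> 0 \<longrightarrow>
        of_real (k\<^sup>2) * r\<^sub>0 \<mu> * conj_plus r\<^sub>0 \<mu>
          = 1 + zeta 2 * s\<^sub>1 \<mu> * conj_plus s\<^sub>2 \<mu> + zeta 1 * s\<^sub>2 \<mu> * conj_plus s\<^sub>1 \<mu>)"
proof (intro ballI impI)
  fix \<mu> assume \<mu>: "\<mu> \<in> \<Lambda>" and t0: "t 0 0 \<mu> \<noteq> 0"
  have mp: "0 < mp" and mm: "0 < mm" using m by (auto simp: admissible_def)
  have eq: "r\<^sub>0 \<mu> * u 0 \<mu> x = v 0 \<mu> x + s\<^sub>1 \<mu> * v 1 \<mu> x + s\<^sub>2 \<mu> * v 2 \<mu> x" for x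
    using t[OF \<mu>, of 0 x] t0 by (simp add: r\<^sub>0 s\<^sub>1 s\<^sub>2 sum_lessThan_3 field_simps)
  have v_lim: "((\<lambda>x. v j \<mu> x - wave mp j \<mu> x) \<longlongrightarrow> 0) at_top" if "j < 3" for j
    using v[OF \<mu> that] unfolding jost_plus_def by blast
  have "((\<lambda>x. (v 0 \<mu> x - wave mp 0 \<mu> x) + s\<^sub>1 \<mu> * (v 1 \<mu> x - wave mp 1 \<mu> x)
      + s\<^sub>2 \<mu> * (v 2 \<mu> x - wave mp 2 \<mu> x)) \<longlongrightarrow> 0 + s\<^sub>1 \<mu> * 0 + s\<^sub>2 \<mu> * 0) at_top"
    by (intro tendsto_add tendsto_mult_left v_lim) auto
  then have top: "((\<lambda>x. r\<^sub>0 \<mu> * u 0 \<mu> x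
      - (wave mp 0 \<mu> x + s\<^sub>1 \<mu> * wave mp 1 \<mu> x + s\<^sub>2 \<mu> * wave mp 2 \<mu> x)) \<longlongrightarrow> 0) at_top"
    unfolding eq by (simp add: algebra_simps)
  have "((\<lambda>x. u 0 \<mu> x - wave mm 0 \<mu> x) \<longlongrightarrow> 0) at_bot"
    using u[OF \<mu> zero_less_numeral] unfolding jost_minus_def by blast
  then have "((\<lambda>x. r\<^sub>0 \<mu> * (u 0 \<mu> x - wave mm 0 \<mu> x)) \<longlongrightarrow> r\<^sub>0 \<mu> * 0) at_bot"
    by (rule tendsto_mult_left)
  then have bot: "((\<lambda>x. r\<^sub>0 \<mu> * u 0 \<mu> x - r\<^sub>0 \<mu> * wave mm 0 \<mu> x) \<longlongrightarrow> 0) at_bot"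
    by (simp add: right_diff_distrib)
  have unit: "of_real (k\<^sup>2) * r\<^sub>0 \<mu> * conj_plus r\<^sub>0 \<mu>
      = 1 + zeta 2 * s\<^sub>1 \<mu> * conj_plus s\<^sub>2 \<mu> + zeta 1 * s\<^sub>2 \<mu> * conj_plus s\<^sub>1 \<mu>"
    if c0: "t 0 0 (cnj \<mu>) \<noteq> 0"
  proof -
    have \<mu>0: "\<mu> \<noteq> 0" using \<mu> \<Lambda>_nonzero by blast
    note \<mu>c = \<Lambda>_conj[OF \<mu>]
    \<comment> \<open>\<open>P\<close> and \<open>Q\<close> are the coefficients of
      \<open>scattering_identity\<close> at \<open>\<mu>\<close> and, conjugated, at
      \<open>cnj \<mu>\<close>. Dividing that identity by \<open>P 0 * Q 0\<close> produces
      \<open>r\<^sub>0\<close>, \<open>s\<^sub>1\<close>, \<open>s\<^sub>2\<close> and their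
      \<open>conj_plus\<close>.\<close>
    define P where "P j = t 0 j \<mu>" for j
    define Q where "Q j = cnj (t 0 j (cnj \<mu>))" for j
    have "of_real ((root 3 mm)\<^sup>2) = of_real ((root 3 mp)\<^sup>2) *
        (P 0 * Q 0 + zeta 2 * P 1 * Q 2 + zeta 1 * P 2 * Q 1)"
      unfolding P_def Q_def
      by (rule scattering_identity[OF mp mm \<mu>0 v[OF \<mu>] v[OF \<mu>c] u[OF \<mu>] u[OF \<mu>c] t[OF \<mu>] t[OF \<mu>c]])
         auto
    then have "of_real (k\<^sup>2) = P 0 * Q 0 + zeta 2 * P 1 * Q 2 + zeta 1 * P 2 * Q 1"
      using mp by (simp add: k power_divide)
    moreover have "P 0 \<noteq> 0" "Q 0 \<noteq> 0" using t0 c0 by (auto simp: P_def Q_def)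
    ultimately have "of_real (k\<^sup>2) * (1 / P 0) * (1 / Q 0)
        = 1 + zeta 2 * (P 1 / P 0) * (Q 2 / Q 0) + zeta 1 * (P 2 / P 0) * (Q 1 / Q 0)"
      by (simp add: field_simps)
    then show ?thesis
      by (simp add: r\<^sub>0 s\<^sub>1 s\<^sub>2 conj_plus_def P_def Q_def)
  qed
  show "(\<forall>x. r\<^sub>0 \<mu> * u 0 \<mu> x = v 0 \<mu> x + s\<^sub>1 \<mu> * v 1 \<mu> x + s\<^sub>2 \<mu> * v 2 \<mu> x) \<and>
      ((\<lambda>x. r\<^sub>0 \<mu> * u 0 \<mu> x
            - (wave mp 0 \<mu> x + s\<^sub>1 \<mu> * wave mp 1 \<mu> x + s\<^sub>2 \<mu> * wave mp 2 \<mu> x)) \<longlongrightarrow> 0) at_top \<and>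
      ((\<lambda>x. r\<^sub>0 \<mu> * u 0 \<mu> x - r\<^sub>0 \<mu> * wave mm 0 \<mu> x) \<longlongrightarrow> 0) at_bot \<and>
      (t 0 0 (cnj \<mu>) \<noteq> 0 \<longrightarrow>
        of_real (k\<^sup>2) * r\<^sub>0 \<mu> * conj_plus r\<^sub>0 \<mu>
          = 1 + zeta 2 * s\<^sub>1 \<mu> * conj_plus s\<^sub>2 \<mu> + zeta 1 * s\<^sub>2 \<mu> * conj_plus s\<^sub>1 \<mu>)"
    using eq top bot unit by blast
qed

end
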